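(* Let $\ell\in\frac12\mathbb{N}$ (with $\ell>0$ in everything concerning $\tilde E$), and let $\{P_n\}_{n\ge0}$ be the monic matrix-valued orthogonal polynomials with respect to the weight $W$ defined in the context. Define the second-order matrix-valued differential operator $$\tilde D=(1-x^2)\frac{d^2}{dx^2}+\Bigl(\frac{d}{dx}\Bigr)(\tilde C-x\tilde U)-\tilde V,$$ $$\tilde C=\sum_{i=0}^{2\ell}(2\ell-i)E_{i,i+1}+\sum_{i=0}^{2\ell}iE_{i,i-1},\quad \tilde U=(2\ell+3)I,\quad \tilde V=-\sum_{i=0}^{2\ell}i(2\ell-i)E_{ii},$$ and the first-order matrix-valued differential operator $$\tilde E=\Bigl(\frac{d}{dx}\Bigr)(\tilde B_0+x\tilde B_1)+\tilde A,$$ $$\tilde B_0=-\sum_{i=0}^{2\ell}\frac{2\ell-i}{4\ell}E_{i,i+1}+\sum_{i=0}^{2\ell}\frac{i}{4\ell}E_{i,i-1},\quad \tilde B_1=\sum_{i=0}^{2\ell}\frac{\ell-i}{2\ell}E_{ii},\quad \tilde A=\sum_{i=0}^{2\ell}\frac{(2\ell+2)(i-2\ell)}{-4\ell}E_{ii}.$$ Then for all $n\ge 0$ $$P_n\tilde D=\Lambda_n(\tilde D)P_n,\qquad \Lambda_n(\tilde D)=\sum_{i=0}^{2\ell}\bigl(-n(n-1)-n(2\ell+3)+i(2\ell-i)\bigr)E_{ii},$$ $$P_n\tilde E=\Lambda_n(\tilde E)P_n,\qquad \Lambda_n(\tilde E)=\sum_{i=0}^{2\ell}\Bigl(\frac{n(\ell-i)}{2\ell}-\frac{(2\ell+2)(i-2\ell)}{4\ell}\Bigr)E_{ii},$$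 the operators $\tilde D$ and $\tilde E$ commute, and both operators are symmetric with respect to $W$, i.e. $\langle P\tilde D,Q\rangle_W=\langle P,Q\tilde D\rangle_W$ and $\langle P\tilde E,Q\rangle_W=\langle P,Q\tilde E\rangle_W$ for all $M_{2\ell+1}(\mathbb{C})$-valued polynomials $P,Q$.
   Context: $\mathbb{N}=\{0,1,2,\dots\}$; rows and columns of $(2\ell+1)\times(2\ell+1)$ matrices are indexed by $0,\dots,2\ell$; $E_{ij}$ are the matrix units, with $E_{ij}=0$ if $i$ or $j$ is out of range; $(a)_k$ is the Pochhammer symbol; $U_r$ is the Chebyshev polynomial of the second kind. The weight is, for $0\le m\le n\le2\ell$ and $x\in[-1,1]$, $$W(x)_{n,m}=\sqrt{1-x^2}\sum_{t=0}^m\alpha_t(m,n)U_{n+m-2t}(x),\quad \alpha_t(m,n)=\frac{2\ell+1}{n+1}\frac{(2\ell-m)!\,m!}{(2\ell)!}(-1)^{m-t}\frac{(n-2\ell)_{m-t}}{(n+2)_{m-t}}\frac{(2\ell+2-t)_t}{t!},$$ and $W(x)_{n,m}=W(x)_{m,n}$ for $n<m$; it is positive definite almost everywhere. For matrix-valued polynomials, $\langle P,Q\rangle_W=\int_{-1}^1P(x)W(x)Q(x)^*\,dx$. $P_n$ is the unique $M_{2\ell+1}(\mathbb{C})$-valued polynomial of degree $n$ with leading coefficient $I$ such that $\langle P_n,P_m\rangle_W=0$ for $n\ne m$. Differential operators act from the right: for $D=\sum_i\frac{d^i}{dx^i}F_i(x)$, $(PD)(x)=\sum_i\frac{d^iP}{dx^i}(x)\,F_i(x)$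 (entrywise derivatives, matrix multiplication by $F_i$ on the right). *)

theory Defs
  imports
    "HOL-Analysis.Henstock_Kurzweil_Integration"
    "Jordan_Normal_Form.Schur_Decomposition"
begin

text \<open>
  The half-integer \<open>\<ell>\<close> is encoded by the natural number \<open>N = 2\<ell>\<close>.
  All matrices have size \<open>(N + 1) \<times> (N + 1)\<close>, with rows and columns indexed by \<open>0, \<dots>, N\<close>.
\<close>

abbreviation ell :: "nat \<Rightarrow> 'a::field_char_0" where
  "ell N \<equiv> of_nat N / 2"

fun chebyshev_U :: "nat \<Rightarrow> real \<Rightarrow> real" where
  "chebyshev_U 0 x = 1"
| "chebyshev_U (Suc 0) x = 2 * x"
| "chebyshev_U (Suc (Suc n)) x = 2 * x * chebyshev_U (Suc n) x - chebyshev_U n x"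

text \<open>
  The coefficient \<open>\<alpha>\<^sub>t(m,n)\<close> is only used for \<open>t \<le> m \<le> n \<le> N\<close>, so the subtractions of natural
  numbers below do not truncate; \<open>n - 2\<ell>\<close>, which is not positive, is a real number.
\<close>

definition alpha :: "nat \<Rightarrow> nat \<Rightarrow> nat \<Rightarrow> nat \<Rightarrow> real" where
  "alpha N t m n =
     real (N + 1) / real (n + 1) * (fact (N - m) * fact m / fact N) * (- 1) ^ (m - t)
     * (pochhammer (real n - real N) (m - t) / pochhammer (real n + 2) (m - t))
     * (pochhammer (real N + 2 - real t) t / fact t)"

definition weight_lower :: "nat \<Rightarrow> nat \<Rightarrow> nat \<Rightarrow> real \<Rightarrow> real" where
  "weight_lower N n m x =
     sqrt (1 - x\<^sup>2) * (\<Sum>t = 0..m. alpha N t m n * chebyshev_U (n + m - 2 * t) x)"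

definition weight :: "nat \<Rightarrow> real \<Rightarrow> complex mat" where
  "weight N x = Matrix.mat (N + 1) (N + 1)
     (\<lambda>(n, m). complex_of_real (if m \<le> n then weight_lower N n m x else weight_lower N m n x))"

text \<open>
  A matrix-valued polynomial is a matrix with polynomial entries.
\<close>

abbreviation matpolys :: "nat \<Rightarrow> complex poly mat set" where
  "matpolys N \<equiv> carrier_mat (N + 1) (N + 1)"

definition eval_mat :: "complex poly mat \<Rightarrow> real \<Rightarrow> complex mat" where
  "eval_mat P x = map_mat (\<lambda>p. poly p (complex_of_real x)) P"

definition const_mat :: "complex mat \<Rightarrow> complex poly mat" where
  "const_mat A = map_mat (\<lambda>c. [:c:]) A"

definition inner_W :: "nat \<Rightarrow> complex poly mat \<Rightarrow> complex poly mat \<Rightarrow> complex mat" where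
  "inner_W N P Q = Matrix.mat (N + 1) (N + 1)
     (\<lambda>(i, j). integral {-1..1}
        (\<lambda>x. (eval_mat P x * weight N x * mat_adjoint (eval_mat Q x)) $$ (i, j)))"

definition monic_of_degree :: "nat \<Rightarrow> nat \<Rightarrow> complex poly mat \<Rightarrow> bool" where
  "monic_of_degree N n P \<longleftrightarrow>
     P \<in> matpolys N \<and> (\<forall>i < N + 1. \<forall>j < N + 1. degree (P $$ (i, j)) \<le> n) \<and>
     map_mat (\<lambda>p. coeff p n) P = 1\<^sub>m (N + 1)"

definition monic_orthogonal_polys :: "nat \<Rightarrow> (nat \<Rightarrow> complex poly mat) \<Rightarrow> bool" where
  "monic_orthogonal_polys N P \<longleftrightarrow>
     (\<forall>n. monic_of_degree N n (P n)) \<and>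
     (\<forall>n m. n \<noteq> m \<longrightarrow> inner_W N (P n) (P m) = 0\<^sub>m (N + 1) (N + 1))"

text \<open>
  The list \<open>[F\<^sub>0, \<dots>, F\<^sub>k]\<close> represents the differential operator \<open>\<Sum>\<^sub>i (d/dx)\<^sup>i F\<^sub>i(x)\<close>, acting from the
  right.
\<close>

type_synonym diffop = "complex poly mat list"

definition act :: "complex poly mat \<Rightarrow> diffop \<Rightarrow> complex poly mat" (infixl "\<lhd>\<^sub>D" 70) where
  "P \<lhd>\<^sub>D Fs = Matrix.mat (dim_row P) (dim_col P)
     (\<lambda>(r, c). \<Sum>i < length Fs. ((map_mat pderiv ^^ i) P * Fs ! i) $$ (r, c))"

definition symmetric_W :: "nat \<Rightarrow> diffop \<Rightarrow> bool" where
  "symmetric_W N Fs \<longleftrightarrow>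
     (\<forall>P \<in> matpolys N. \<forall>Q \<in> matpolys N. inner_W N (P \<lhd>\<^sub>D Fs) Q = inner_W N P (Q \<lhd>\<^sub>D Fs))"

definition diffops_commute :: "nat \<Rightarrow> diffop \<Rightarrow> diffop \<Rightarrow> bool" where
  "diffops_commute N Fs Gs \<longleftrightarrow> (\<forall>P \<in> matpolys N. (P \<lhd>\<^sub>D Fs) \<lhd>\<^sub>D Gs = (P \<lhd>\<^sub>D Gs) \<lhd>\<^sub>D Fs)"

definition diag_of :: "nat \<Rightarrow> (nat \<Rightarrow> complex) \<Rightarrow> complex mat" where
  "diag_of N f = Matrix.mat (N + 1) (N + 1) (\<lambda>(i, j). if i = j then f i else 0)"

text \<open>
  The matrix \<open>\<Sum>\<^sub>i (u i E\<^sub>i\<^sub>,\<^sub>i\<^sub>+\<^sub>1 + d i E\<^sub>i\<^sub>,\<^sub>i\<^sub>-\<^sub>1)\<close> with \<open>i\<close> from \<open>0\<close> to \<open>N\<close>, where the matrix units with an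
  index out of range vanish.
\<close>

definition off_diag :: "nat \<Rightarrow> (nat \<Rightarrow> complex) \<Rightarrow> (nat \<Rightarrow> complex) \<Rightarrow> complex mat" where
  "off_diag N u d = Matrix.mat (N + 1) (N + 1)
     (\<lambda>(i, j). if j = i + 1 then u i else if i = j + 1 then d i else 0)"

definition C_mat :: "nat \<Rightarrow> complex mat" where
  "C_mat N = off_diag N (\<lambda>i. 2 * ell N - of_nat i) (\<lambda>i. of_nat i)"

definition U_mat :: "nat \<Rightarrow> complex mat" where
  "U_mat N = (2 * ell N + 3) \<cdot>\<^sub>m 1\<^sub>m (N + 1)"

definition V_mat :: "nat \<Rightarrow> complex mat" where
  "V_mat N = - diag_of N (\<lambda>i. of_nat i * (2 * ell N - of_nat i))"

definition D_op :: "nat \<Rightarrow> diffop" where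
  "D_op N =
     [- const_mat (V_mat N),
      const_mat (C_mat N) - [:0, 1:] \<cdot>\<^sub>m const_mat (U_mat N),
      (1 - [:0, 1:]\<^sup>2) \<cdot>\<^sub>m 1\<^sub>m (N + 1)]"

definition B0_mat :: "nat \<Rightarrow> complex mat" where
  "B0_mat N =
     off_diag N (\<lambda>i. - ((2 * ell N - of_nat i) / (4 * ell N))) (\<lambda>i. of_nat i / (4 * ell N))"

definition B1_mat :: "nat \<Rightarrow> complex mat" where
  "B1_mat N = diag_of N (\<lambda>i. (ell N - of_nat i) / (2 * ell N))"

definition A_mat :: "nat \<Rightarrow> complex mat" where
  "A_mat N = diag_of N (\<lambda>i. (2 * ell N + 2) * (of_nat i - 2 * ell N) / (- (4 * ell N)))"

definition E_op :: "nat \<Rightarrow> diffop" where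
  "E_op N =
     [const_mat (A_mat N),
      const_mat (B0_mat N) + [:0, 1:] \<cdot>\<^sub>m const_mat (B1_mat N)]"

definition Lambda_D :: "nat \<Rightarrow> nat \<Rightarrow> complex mat" where
  "Lambda_D N n = diag_of N
     (\<lambda>i. - (of_nat n * (of_nat n - 1)) - of_nat n * (2 * ell N + 3)
          + of_nat i * (2 * ell N - of_nat i))"

definition Lambda_E :: "nat \<Rightarrow> nat \<Rightarrow> complex mat" where
  "Lambda_E N n = diag_of N
     (\<lambda>i. of_nat n * (ell N - of_nat i) / (2 * ell N)
          - (2 * ell N + 2) * (of_nat i - 2 * ell N) / (4 * ell N))"

end

theory Submission
  imports Defs "HOL-Analysis.Equivalence_Lebesgue_Henstock_Integration"
begin

text \<open>
  Put \<open>x = cos \<theta>\<close> and write \<open>A k\<close> for the binomial coefficient \<open>N + 1\<close> over \<open>k\<close>. The coefficients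
  \<open>\<alpha>\<^sub>t(m,n)\<close> are products of binomial coefficients, and for all \<open>a, b \<le> N\<close>, whichever of them is
  larger, the entry \<open>W(x)\<^sub>a\<^sub>b\<close> is the sum of \<open>A t \<cdot> A (a + b + 1 - t) \<cdot> sin ((a + b + 1 - 2 t) \<theta>)\<close>
  over \<open>t \<le> a\<close>, divided by \<open>(N choose a) (N choose b)\<close> (lemma \<open>weight_entry_trig\<close>). Summing up to
  \<open>b\<close> gives the same value, because the terms in between cancel under \<open>t \<mapsto> a + b + 1 - t\<close>.

  Multiplying this sum by \<open>cos \<theta>\<close> or differentiating it shifts the frequencies by one, and the rule
  \<open>t A t = (N + 2 - t) A (t - 1)\<close> recognizes the result as a combination of the neighbouring
  entries, those with one index changed by one. The four relations obtained in this way (lemmas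
  \<open>lowering_relation\<close>, \<open>raising_relation\<close>, \<open>lowering_derivative\<close>, \<open>raising_derivative\<close>)
  combine to the symmetry equations of both operators. For an operator with coefficients
  \<open>F\<^sub>2, F\<^sub>1, F\<^sub>0\<close> these equations say that \<open>G = F\<^sub>2 W\<close> is symmetric, that the symmetric part of
  \<open>F\<^sub>1 W\<close> is \<open>G'\<close>, and that its antisymmetric part \<open>K\<close> satisfies \<open>K' = F\<^sub>0 W - (F\<^sub>0 W)\<^sup>T\<close>.
  Since \<open>W\<close> vanishes at both end points, integration by parts then yields the symmetry of the
  operator (lemma \<open>pairing_symmetric_criterion\<close>).

  The pairing defined by \<open>W\<close> has trivial radical (lemma \<open>pairing_nondegenerate\<close>): the entries of
  \<open>w = W / sqrt (1 - x\<^sup>2)\<close> are polynomials of degree at most \<open>a + b\<close>, and the coefficient of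
  \<open>x\<^sup>a\<^sup>+\<^sup>b\<close> vanishes exactly when \<open>a + b > N\<close>. The matrix of these coefficients is therefore
  triangular with respect to the antidiagonal, with nonzero antidiagonal, so that \<open>p w = 0\<close> forces
  \<open>p = 0\<close> for a polynomial row vector \<open>p\<close>.

  Finally let \<open>R = P\<^sub>n D - \<Lambda>\<^sub>n P\<^sub>n\<close>. The operator does not raise degrees and multiplies the leading
  coefficient by the diagonal matrix \<open>\<Lambda>\<^sub>n\<close>, so \<open>R\<close> has degree less than \<open>n\<close> and is orthogonal to
  \<open>P\<^sub>m\<close> for \<open>m \<ge> n\<close>. For \<open>m < n\<close> symmetry moves the operator to \<open>P\<^sub>m\<close>, so \<open>R\<close> is orthogonal to
  \<open>P\<^sub>m\<close> as well. Hence \<open>R\<close> lies in the radical and vanishes (lemma \<open>eigenrow\<close>). The rows of the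
  \<open>P\<^sub>n\<close> span all polynomial rows and both operators act on each of them by a scalar, which gives the
  commutation (lemma \<open>commute_rows\<close>).

  An operator acts on each row of a matrix separately, and the entry \<open>(i, j)\<close> of \<open>\<langle>P, Q\<rangle>\<^sub>W\<close> involves
  only row \<open>i\<close> of \<open>P\<close> and row \<open>j\<close> of \<open>Q\<close>. The argument is therefore carried out for single rows,
  represented as functions from column indices to polynomials, of which only the values at indices
  up to \<open>N\<close> matter.
\<close>

section \<open>Sums of sines with products of binomial coefficients\<close>

definition binomial_pair :: "nat \<Rightarrow> nat \<Rightarrow> nat \<Rightarrow> real" where
  "binomial_pair N r t = real (N + 1 choose t) * real (N + 1 choose (r - t))"

definition sine_term :: "nat \<Rightarrow> nat \<Rightarrow> nat \<Rightarrow> real \<Rightarrow> real" where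
  "sine_term N r t \<theta> = binomial_pair N r t * sin ((real r - 2 * real t) * \<theta>)"

definition sine_term_deriv :: "nat \<Rightarrow> nat \<Rightarrow> nat \<Rightarrow> real \<Rightarrow> real" where
  "sine_term_deriv N r t \<theta> =
     (real r - 2 * real t) * (binomial_pair N r t * cos ((real r - 2 * real t) * \<theta>))"

lemma has_derivative_sine_term:
  "(sine_term N r t has_real_derivative sine_term_deriv N r t \<theta>) (at \<theta>)"
  unfolding sine_term_def [abs_def] sine_term_deriv_def
  by (auto intro!: derivative_eq_intros)

lemma sine_term_reverse:
  assumes "t \<le> r"
  shows "sine_term N r (r - t) \<theta> = - sine_term N r t \<theta>"
proof -
  have "(real r - 2 * real (r - t)) * \<theta> = - ((real r - 2 * real t) * \<theta>)"
    using assms by (simp add: of_nat_diff algebra_simps)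
  then have "sin ((real r - 2 * real (r - t)) * \<theta>) = - sin ((real r - 2 * real t) * \<theta>)"
    by (simp only: sin_minus)
  then show ?thesis
    using assms by (simp add: sine_term_def binomial_pair_def)
qed

text \<open>
  The reflection \<open>t \<mapsto> r - t\<close> keeps the binomial coefficients and reverses the sign of the sine.
\<close>

lemma sum_sine_term_symmetric_interval:
  assumes "p + q = r"
  shows "(\<Sum>t = p..q. sine_term N r t \<theta>) = 0"
proof -
  have "(\<Sum>t = p..q. sine_term N r t \<theta>) = (\<Sum>t = p..q. sine_term N r (r - t) \<theta>)"
    by (subst sum.atLeastAtMost_rev) (use assms in \<open>simp add: add.commute\<close>)
  also have "\<dots> = - (\<Sum>t = p..q. sine_term N r t \<theta>)"
    using assms by (simp add: sine_term_reverse sum_negf)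
  finally show ?thesis by simp
qed

text \<open>
  The two sums differ by a sum over an interval that the reflection \<open>t \<mapsto> a + b + 1 - t\<close> preserves.
  This makes the weight formula symmetric in its indices, so that no case distinction between
  \<open>a \<le> b\<close> and \<open>b \<le> a\<close> is needed below.
\<close>

lemma sum_sine_term_swap:
  "(\<Sum>t\<le>a. sine_term N (a + b + 1) t \<theta>) = (\<Sum>t\<le>b. sine_term N (a + b + 1) t \<theta>)"
proof -
  have *: "(\<Sum>t\<le>a. sine_term N (a + b + 1) t \<theta>) = (\<Sum>t\<le>b. sine_term N (a + b + 1) t \<theta>)"
    if "b \<le> a" for a b
  proof -
    have "{..a} = {..b} \<union> {b + 1..a}" using that by auto
    then have "(\<Sum>t\<le>a. sine_term N (a + b + 1) t \<theta>) =
      (\<Sum>t\<le>b. sine_term N (a + b + 1) t \<theta>) + (\<Sum>t = b + 1..a. sine_term N (a + b + 1) t \<theta>)"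
      by (simp only:) (subst sum.union_disjoint, auto)
    moreover have "(\<Sum>t = b + 1..a. sine_term N (a + b + 1) t \<theta>) = 0"
      by (rule sum_sine_term_symmetric_interval) simp
    ultimately show ?thesis by simp
  qed
  show ?thesis
  proof (cases "b \<le> a")
    case True
    then show ?thesis by (rule *)
  next
    case False
    then show ?thesis using *[of a b] by (simp add: add.commute[of b a])
  qed
qed

lemma binomial_absorb_real:
  "real (Suc t) * real (n choose Suc t) = (real n - real t) * real (n choose t)"
proof (cases "t \<le> n")
  case True
  have "Suc t * (n choose Suc t) = (n - t) * (n choose t)"
    using binomial_absorb_comp[of n t] binomial_absorption[of t n] by simp
  then have "real (Suc t * (n choose Suc t)) = real ((n - t) * (n choose t))"
    by (simp only:)
  then show ?thesis using True by (simp only: of_nat_mult of_nat_diff)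
next
  case False
  then have "n choose t = 0" "n choose Suc t = 0" by simp_all
  then show ?thesis by (simp only: of_nat_0 mult_zero_right)
qed

lemma binomial_absorb_real':
  assumes "t < r"
  shows "(real r - real t) * real (n choose (r - t))
    = (real n - real r + real t + 1) * real (n choose (r - t - 1))"
proof -
  have "Suc (r - t - 1) = r - t" using assms by simp
  moreover have "real (r - t) = real r - real t" "real (r - t - 1) = real r - real t - 1"
    using assms by (auto simp: of_nat_diff)
  ultimately show ?thesis
    using binomial_absorb_real[of "r - t - 1" n] by (simp only:) (simp add: algebra_simps)
qed

lemma sum_shift_down:
  "(\<Sum>t\<le>(a::nat). u t + (if t = 0 then 0 else v (t - 1))) = (\<Sum>t<a. u t + v t) + (u a :: real)"
  by (induction a) auto

lemma sum_shift_up: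
  "(\<Sum>t\<le>a. u t + v (Suc t)) = (\<Sum>t\<le>a. u t + v t) + v (Suc a) - (v 0 :: real)"
  by (induction a) auto

text \<open>
  Multiplication by \<open>cos \<theta>\<close> or \<open>sin \<theta>\<close> leads from the frequency \<open>r + 1 - 2 t\<close> to the two
  frequencies \<open>r - 2 t\<close> and \<open>r + 2 - 2 t\<close>, which belong to sums with parameter \<open>r\<close> and \<open>r + 2\<close>.
\<close>

lemma trig_shift:
  fixes r t :: nat and \<theta> :: real
  defines "k \<equiv> (real (r + 1) - 2 * real t) * \<theta>"
  shows "sin ((real r - 2 * real t) * \<theta>) = sin k * cos \<theta> - cos k * sin \<theta>"
    and "sin ((real (r + 2) - 2 * real t) * \<theta>) = sin k * cos \<theta> + cos k * sin \<theta>"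
    and "cos ((real r - 2 * real t) * \<theta>) = cos k * cos \<theta> + sin k * sin \<theta>"
    and "cos ((real (r + 2) - 2 * real t) * \<theta>) = cos k * cos \<theta> - sin k * sin \<theta>"
proof -
  have "(real r - 2 * real t) * \<theta> = k - \<theta>" "(real (r + 2) - 2 * real t) * \<theta> = k + \<theta>"
    by (simp_all add: k_def algebra_simps)
  then show "sin ((real r - 2 * real t) * \<theta>) = sin k * cos \<theta> - cos k * sin \<theta>"
    "sin ((real (r + 2) - 2 * real t) * \<theta>) = sin k * cos \<theta> + cos k * sin \<theta>"
    "cos ((real r - 2 * real t) * \<theta>) = cos k * cos \<theta> + sin k * sin \<theta>"
    "cos ((real (r + 2) - 2 * real t) * \<theta>) = cos k * cos \<theta> - sin k * sin \<theta>"
    by (simp_all add: sin_diff sin_add cos_diff cos_add)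
qed

lemma binomial_pair_lower_right:
  assumes "t \<le> s"
  shows "(real s + 1 - real t) * binomial_pair N (s + 1) t = (real N + 1 - real s + real t) * binomial_pair N s t"
proof -
  have "(real s + 1 - real t) * real (N + 1 choose (s + 1 - t))
    = (real N + 1 - real s + real t) * real (N + 1 choose (s - t))"
    using binomial_absorb_real'[of t "s + 1" "N + 1"] assms
    by (simp add: Suc_diff_le add_ac del: binomial_Suc_Suc)
  then show ?thesis unfolding binomial_pair_def by (metis mult.left_commute)
qed

lemma binomial_pair_lower_left:
  assumes "t \<le> s + 1" "t > 0"
  shows "real t * binomial_pair N (s + 1) t = (real N + 2 - real t) * binomial_pair N s (t - 1)"
proof -
  have "real t * real (N + 1 choose t) = (real N + 2 - real t) * real (N + 1 choose (t - 1))"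
    using binomial_absorb_real[of "t - 1" "N + 1"] assms by (simp add: of_nat_diff)
  moreover have "s + 1 - t = s - (t - 1)" using assms by simp
  ultimately show ?thesis unfolding binomial_pair_def by (metis mult.assoc)
qed

lemma binomial_pair_raise_left:
  "(real N + 1 - real t) * binomial_pair N (s + 1) t = real (Suc t) * binomial_pair N (s + 2) (Suc t)"
proof -
  have "(real N + 1 - real t) * real (N + 1 choose t) = real (Suc t) * real (N + 1 choose Suc t)"
    using binomial_absorb_real[of t "N + 1"] by (simp del: binomial_Suc_Suc)
  moreover have "s + 2 - Suc t = s + 1 - t" by simp
  ultimately show ?thesis unfolding binomial_pair_def by (metis mult.assoc)
qed

lemma binomial_pair_raise_right:
  assumes "t \<le> s + 1"
  shows "(real N - real s + real t) * binomial_pair N (s + 1) t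
    = (real s + 2 - real t) * binomial_pair N (s + 2) t"
proof -
  have "(real N - real s + real t) * real (N + 1 choose (s + 1 - t))
    = (real s + 2 - real t) * real (N + 1 choose (s + 2 - t))"
  proof -
    have "s + 2 - t - 1 = s + 1 - t" by simp
    moreover have "real (N + 1) - real (s + 2) + real t + 1 = real N - real s + real t" by simp
    moreover have "real (s + 2) - real t = real s + 2 - real t" by simp
    ultimately show ?thesis
      using binomial_absorb_real'[of t "s + 2" "N + 1"] assms by (metis le_imp_less_Suc add_2_eq_Suc' Suc_eq_plus1)
  qed
  then show ?thesis unfolding binomial_pair_def by (metis mult.left_commute)
qed

text \<open>
  The right-hand side contains the frequencies \<open>s - 2 t\<close> and \<open>s + 2 - 2 t\<close>, where \<open>s = a + b\<close>, with
  the factors \<open>s + 1 - t\<close> and \<open>t\<close>. Each factor is absorbed by one of the two binomial coefficients,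
  which lowers the parameter from \<open>s + 1\<close> to \<open>s\<close>. After the shift \<open>t \<mapsto> t - 1\<close> in the second group
  the factors \<open>N + 1 - s + t\<close> and \<open>N + 1 - t\<close> add up to a constant, except at the end \<open>t = a\<close>, which
  has no partner.
\<close>

lemma lower_sum:
  "(real N + 1 - real a) * (\<Sum>t<a. sine_term N (a + b) t \<theta>)
     + (real N + 1 - real b) * (\<Sum>t\<le>a. sine_term N (a + b) t \<theta>)
   = - sin \<theta> * (\<Sum>t\<le>a. sine_term_deriv N (a + b + 1) t \<theta>)
     + (real a + real b + 1) * cos \<theta> * (\<Sum>t\<le>a. sine_term N (a + b + 1) t \<theta>)"
proof -
  define s where "s = a + b"
  have *: "- sin \<theta> * sine_term_deriv N (s + 1) t \<theta> + (real s + 1) * cos \<theta> * sine_term N (s + 1) t \<theta>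
    = (real N + 1 - real s + real t) * sine_term N s t \<theta>
      + (if t = 0 then 0 else (real N + 1 - real (t - 1)) * sine_term N s (t - 1) \<theta>)"
    if "t \<le> a" for t
  proof -
    have t: "t \<le> s" using that by (simp add: s_def)
    have "- sin \<theta> * sine_term_deriv N (s + 1) t \<theta> + (real s + 1) * cos \<theta> * sine_term N (s + 1) t \<theta>
      = ((real s + 1 - real t) * binomial_pair N (s + 1) t) * sin ((real s - 2 * real t) * \<theta>)
        + (real t * binomial_pair N (s + 1) t) * sin ((real (s + 2) - 2 * real t) * \<theta>)"
      unfolding trig_shift[of s] sine_term_def sine_term_deriv_def by (simp add: algebra_simps)
    also have "((real s + 1 - real t) * binomial_pair N (s + 1) t) * sin ((real s - 2 * real t) * \<theta>)
      = (real N + 1 - real s + real t) * sine_term N s t \<theta>"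
      using t by (subst binomial_pair_lower_right) (simp_all add: sine_term_def)
    also have "(real t * binomial_pair N (s + 1) t) * sin ((real (s + 2) - 2 * real t) * \<theta>)
      = (if t = 0 then 0 else (real N + 1 - real (t - 1)) * sine_term N s (t - 1) \<theta>)"
    proof (cases "t = 0")
      case False
      then have "(real t * binomial_pair N (s + 1) t) = (real N + 1 - real (t - 1)) * binomial_pair N s (t - 1)"
        "real (s + 2) - 2 * real t = real s - 2 * real (t - 1)"
        using t binomial_pair_lower_left[of t s N] by (auto simp: of_nat_diff)
      then show ?thesis using False by (simp only: sine_term_def) simp
    qed simp
    finally show ?thesis .
  qed
  have "- sin \<theta> * (\<Sum>t\<le>a. sine_term_deriv N (s + 1) t \<theta>)
     + (real s + 1) * cos \<theta> * (\<Sum>t\<le>a. sine_term N (s + 1) t \<theta>)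
    = (\<Sum>t\<le>a. (real N + 1 - real s + real t) * sine_term N s t \<theta>
      + (if t = 0 then 0 else (real N + 1 - real (t - 1)) * sine_term N s (t - 1) \<theta>))"
    unfolding sum_distrib_left sum.distrib [symmetric] by (intro sum.cong refl *) simp
  also have "\<dots> = (\<Sum>t<a. (2 * real N + 2 - real s) * sine_term N s t \<theta>)
      + (real N + 1 - real b) * sine_term N s a \<theta>"
    unfolding sum_shift_down[where v = "\<lambda>t. (real N + 1 - real t) * sine_term N s t \<theta>"]
    by (intro arg_cong2[where f = "(+)"] sum.cong refl) (auto simp: algebra_simps s_def)
  also have "\<dots> = (real N + 1 - real a) * (\<Sum>t<a. sine_term N s t \<theta>)
     + (real N + 1 - real b) * (\<Sum>t\<le>a. sine_term N s t \<theta>)"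
    unfolding sum_distrib_left[symmetric] lessThan_Suc_atMost[symmetric]
    by (simp add: s_def algebra_simps)
  finally show ?thesis by (simp add: s_def)
qed

text \<open>
  The counterpart of the previous lemma for the factors \<open>N + 1 - t\<close> and \<open>N - s + t\<close>, whose absorption
  raises the parameter from \<open>s + 1\<close> to \<open>s + 2\<close>.
\<close>

lemma raise_sum:
  "(real a + 1) * (\<Sum>t\<le>a + 1. sine_term N (a + b + 2) t \<theta>)
     + (real b + 1) * (\<Sum>t\<le>a. sine_term N (a + b + 2) t \<theta>)
   = - sin \<theta> * (\<Sum>t\<le>a. sine_term_deriv N (a + b + 1) t \<theta>)
     + (2 * real N + 1 - real a - real b) * cos \<theta> * (\<Sum>t\<le>a. sine_term N (a + b + 1) t \<theta>)"
proof -
  define s where "s = a + b"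
  have *: "- sin \<theta> * sine_term_deriv N (s + 1) t \<theta>
      + (2 * real N + 1 - real s) * cos \<theta> * sine_term N (s + 1) t \<theta>
    = (real s + 2 - real t) * sine_term N (s + 2) t \<theta>
      + real (Suc t) * sine_term N (s + 2) (Suc t) \<theta>"
    if "t \<le> a" for t
  proof -
    have t: "t \<le> s" using that by (simp add: s_def)
    have "- sin \<theta> * sine_term_deriv N (s + 1) t \<theta>
        + (2 * real N + 1 - real s) * cos \<theta> * sine_term N (s + 1) t \<theta>
      = ((real N - real s + real t) * binomial_pair N (s + 1) t) * sin ((real (s + 2) - 2 * real t) * \<theta>)
        + ((real N + 1 - real t) * binomial_pair N (s + 1) t) * sin ((real s - 2 * real t) * \<theta>)"
      unfolding trig_shift[of s] sine_term_def sine_term_deriv_def by (simp add: algebra_simps)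
    also have "((real N + 1 - real t) * binomial_pair N (s + 1) t) * sin ((real s - 2 * real t) * \<theta>)
      = real (Suc t) * sine_term N (s + 2) (Suc t) \<theta>"
    proof -
      have "real s - 2 * real t = real (s + 2) - 2 * real (Suc t)" by simp
      then show ?thesis by (simp only: binomial_pair_raise_left sine_term_def mult.assoc)
    qed
    also have "(real N - real s + real t) * binomial_pair N (s + 1) t
      = (real s + 2 - real t) * binomial_pair N (s + 2) t"
      using t by (intro binomial_pair_raise_right) simp
    finally show ?thesis by (simp only: sine_term_def mult.assoc mult_minus_left)
  qed
  have "- sin \<theta> * (\<Sum>t\<le>a. sine_term_deriv N (s + 1) t \<theta>)
     + (2 * real N + 1 - real s) * cos \<theta> * (\<Sum>t\<le>a. sine_term N (s + 1) t \<theta>)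
    = (\<Sum>t\<le>a. (real s + 2 - real t) * sine_term N (s + 2) t \<theta>
      + real (Suc t) * sine_term N (s + 2) (Suc t) \<theta>)"
    unfolding sum_distrib_left sum.distrib [symmetric] by (intro sum.cong refl *) simp
  also have "\<dots> = (\<Sum>t\<le>a. (real s + 2) * sine_term N (s + 2) t \<theta>)
      + (real a + 1) * sine_term N (s + 2) (Suc a) \<theta>"
    unfolding sum_shift_up[where v = "\<lambda>t. real t * sine_term N (s + 2) t \<theta>"]
    by (simp add: algebra_simps)
  also have "\<dots> = (real a + 1) * (\<Sum>t\<le>a + 1. sine_term N (s + 2) t \<theta>)
     + (real b + 1) * (\<Sum>t\<le>a. sine_term N (s + 2) t \<theta>)"
    unfolding sum_distrib_left[symmetric]
    by (simp add: s_def algebra_simps)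
  finally show ?thesis by (simp add: s_def diff_diff_eq)
qed

text \<open>
  Here the two groups of cosines have factors of opposite sign, so that they do not add up to a
  constant but to \<open>2 t - s\<close>, which is, up to sign, the frequency: the result is a differentiated
  sine.
\<close>

lemma lower_sum_deriv:
  "(real N + 1 - real a) * (\<Sum>t<a. sine_term_deriv N (a + b) t \<theta>)
     - (real N + 1 - real b) * (\<Sum>t\<le>a. sine_term_deriv N (a + b) t \<theta>)
   = (real a - real b) *
     ((real a + real b + 1) * sin \<theta> * (\<Sum>t\<le>a. sine_term N (a + b + 1) t \<theta>)
      + cos \<theta> * (\<Sum>t\<le>a. sine_term_deriv N (a + b + 1) t \<theta>))"
proof -
  define s where "s = a + b"
  \<comment> \<open>The differentiated sine without its frequency factor.\<close>
  define c where "c t = binomial_pair N s t * cos ((real s - 2 * real t) * \<theta>)" for t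
  have *: "(real s + 1) * sin \<theta> * sine_term N (s + 1) t \<theta> + cos \<theta> * sine_term_deriv N (s + 1) t \<theta>
    = (real N + 1 - real s + real t) * c t
      + (if t = 0 then 0 else - ((real N + 1 - real (t - 1)) * c (t - 1)))"
    if "t \<le> a" for t
  proof -
    have t: "t \<le> s" using that by (simp add: s_def)
    have "(real s + 1) * sin \<theta> * sine_term N (s + 1) t \<theta> + cos \<theta> * sine_term_deriv N (s + 1) t \<theta>
      = ((real s + 1 - real t) * binomial_pair N (s + 1) t) * cos ((real s - 2 * real t) * \<theta>)
        + - (real t * binomial_pair N (s + 1) t) * cos ((real (s + 2) - 2 * real t) * \<theta>)"
      unfolding trig_shift[of s] sine_term_def sine_term_deriv_def by (simp add: algebra_simps)
    also have "((real s + 1 - real t) * binomial_pair N (s + 1) t) * cos ((real s - 2 * real t) * \<theta>)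
      = (real N + 1 - real s + real t) * c t"
      using t by (subst binomial_pair_lower_right) (simp_all add: c_def)
    also have "- (real t * binomial_pair N (s + 1) t) * cos ((real (s + 2) - 2 * real t) * \<theta>)
      = (if t = 0 then 0 else - ((real N + 1 - real (t - 1)) * c (t - 1)))"
    proof (cases "t = 0")
      case False
      then have "(real t * binomial_pair N (s + 1) t) = (real N + 1 - real (t - 1)) * binomial_pair N s (t - 1)"
        "real (s + 2) - 2 * real t = real s - 2 * real (t - 1)"
        using t binomial_pair_lower_left[of t s N] by (auto simp: of_nat_diff)
      then show ?thesis using False by (simp only: c_def) simp
    qed simp
    finally show ?thesis .
  qed
  have "(real s + 1) * sin \<theta> * (\<Sum>t\<le>a. sine_term N (s + 1) t \<theta>)
      + cos \<theta> * (\<Sum>t\<le>a. sine_term_deriv N (s + 1) t \<theta>)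
    = (\<Sum>t\<le>a. (real N + 1 - real s + real t) * c t
      + (if t = 0 then 0 else - ((real N + 1 - real (t - 1)) * c (t - 1))))"
    unfolding sum_distrib_left sum.distrib [symmetric] by (intro sum.cong refl *) simp
  also have "\<dots> = (\<Sum>t<a. - sine_term_deriv N s t \<theta>) + (real N + 1 - real b) * c a"
    unfolding sum_shift_down[where v = "\<lambda>t. - ((real N + 1 - real t) * c t)"]
    by (intro arg_cong2[where f = "(+)"] sum.cong refl)
      (auto simp: algebra_simps s_def c_def sine_term_deriv_def)
  finally have right: "(real s + 1) * sin \<theta> * (\<Sum>t\<le>a. sine_term N (s + 1) t \<theta>)
      + cos \<theta> * (\<Sum>t\<le>a. sine_term_deriv N (s + 1) t \<theta>)
    = (real N + 1 - real b) * c a - (\<Sum>t<a. sine_term_deriv N s t \<theta>)"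
    by (simp add: sum_negf)
  have "(\<Sum>t\<le>a. sine_term_deriv N s t \<theta>)
    = (\<Sum>t<a. sine_term_deriv N s t \<theta>) + (real b - real a) * c a"
    unfolding lessThan_Suc_atMost[symmetric] by (simp add: sine_term_deriv_def c_def s_def)
  then have "(real N + 1 - real a) * (\<Sum>t<a. sine_term_deriv N s t \<theta>)
     - (real N + 1 - real b) * (\<Sum>t\<le>a. sine_term_deriv N s t \<theta>)
    = (real a - real b) * ((real N + 1 - real b) * c a - (\<Sum>t<a. sine_term_deriv N s t \<theta>))"
    by (simp only:) (simp add: algebra_simps)
  then show ?thesis
    unfolding right[symmetric] by (simp add: s_def)
qed

text \<open>
  The counterpart of the previous lemma with raised instead of lowered parameter.
\<close>

lemma raise_sum_deriv:
  "(real a + 1) * (\<Sum>t\<le>a + 1. sine_term_deriv N (a + b + 2) t \<theta>)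
     - (real b + 1) * (\<Sum>t\<le>a. sine_term_deriv N (a + b + 2) t \<theta>)
   = - (real a - real b) *
     ((2 * real N + 1 - real a - real b) * sin \<theta> * (\<Sum>t\<le>a. sine_term N (a + b + 1) t \<theta>)
      + cos \<theta> * (\<Sum>t\<le>a. sine_term_deriv N (a + b + 1) t \<theta>))"
proof -
  define s where "s = a + b"
  define c where "c t = binomial_pair N (s + 2) t * cos ((real (s + 2) - 2 * real t) * \<theta>)" for t
  have *: "(2 * real N + 1 - real s) * sin \<theta> * sine_term N (s + 1) t \<theta>
      + cos \<theta> * sine_term_deriv N (s + 1) t \<theta>
    = - ((real s + 2 - real t) * c t) + real (Suc t) * c (Suc t)"
    if "t \<le> a" for t
  proof -
    have t: "t \<le> s" using that by (simp add: s_def)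
    have "(2 * real N + 1 - real s) * sin \<theta> * sine_term N (s + 1) t \<theta>
      + cos \<theta> * sine_term_deriv N (s + 1) t \<theta>
      = - ((real N - real s + real t) * binomial_pair N (s + 1) t) * cos ((real (s + 2) - 2 * real t) * \<theta>)
        + ((real N + 1 - real t) * binomial_pair N (s + 1) t) * cos ((real s - 2 * real t) * \<theta>)"
      unfolding trig_shift[of s] sine_term_def sine_term_deriv_def by (simp add: algebra_simps)
    also have "((real N + 1 - real t) * binomial_pair N (s + 1) t) * cos ((real s - 2 * real t) * \<theta>)
      = real (Suc t) * c (Suc t)"
    proof -
      have "real s - 2 * real t = real (s + 2) - 2 * real (Suc t)" by simp
      then show ?thesis by (simp only: binomial_pair_raise_left c_def mult.assoc)
    qed
    also have "(real N - real s + real t) * binomial_pair N (s + 1) t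
      = (real s + 2 - real t) * binomial_pair N (s + 2) t"
      using t by (intro binomial_pair_raise_right) simp
    finally show ?thesis by (simp only: c_def mult.assoc mult_minus_left)
  qed
  have "(2 * real N + 1 - real s) * sin \<theta> * (\<Sum>t\<le>a. sine_term N (s + 1) t \<theta>)
      + cos \<theta> * (\<Sum>t\<le>a. sine_term_deriv N (s + 1) t \<theta>)
    = (\<Sum>t\<le>a. - ((real s + 2 - real t) * c t) + real (Suc t) * c (Suc t))"
    unfolding sum_distrib_left sum.distrib [symmetric] by (intro sum.cong refl *) simp
  also have "\<dots> = (\<Sum>t\<le>a. - sine_term_deriv N (s + 2) t \<theta>) + (real a + 1) * c (Suc a)"
    unfolding sum_shift_up[where v = "\<lambda>t. real t * c t"]
    by (simp add: algebra_simps c_def sine_term_deriv_def)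
  finally have right: "(2 * real N + 1 - real s) * sin \<theta> * (\<Sum>t\<le>a. sine_term N (s + 1) t \<theta>)
      + cos \<theta> * (\<Sum>t\<le>a. sine_term_deriv N (s + 1) t \<theta>)
    = (real a + 1) * c (Suc a) - (\<Sum>t\<le>a. sine_term_deriv N (s + 2) t \<theta>)"
    by (simp add: sum_negf)
  have "(\<Sum>t\<le>a + 1. sine_term_deriv N (s + 2) t \<theta>)
    = (\<Sum>t\<le>a. sine_term_deriv N (s + 2) t \<theta>) + (real b - real a) * c (Suc a)"
    by (simp add: sine_term_deriv_def c_def s_def)
  then have "(real a + 1) * (\<Sum>t\<le>a + 1. sine_term_deriv N (s + 2) t \<theta>)
     - (real b + 1) * (\<Sum>t\<le>a. sine_term_deriv N (s + 2) t \<theta>)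
    = - (real a - real b)
      * ((real a + 1) * c (Suc a) - (\<Sum>t\<le>a. sine_term_deriv N (s + 2) t \<theta>))"
    by (simp only:) (simp add: algebra_simps)
  then show ?thesis
    unfolding right[symmetric] by (simp add: s_def diff_diff_eq)
qed

section \<open>The weight as a truncated sum of sines\<close>

lemma chebyshev_U_sin:
  assumes "x \<in> {-1..1}"
  shows "sqrt (1 - x\<^sup>2) * chebyshev_U k x = sin (real (k + 1) * arccos x)"
proof -
  define \<theta> where "\<theta> = arccos x"
  have x: "x = cos \<theta>" "sqrt (1 - x\<^sup>2) = sin \<theta>"
    using assms by (auto simp: sin_arccos_abs abs_le_iff \<theta>_def)
  have "sin \<theta> * chebyshev_U k (cos \<theta>) = sin (real (k + 1) * \<theta>)"
  proof (induction k rule: induct_nat_012)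
    case 0
    then show ?case by simp
  next
    case 1
    then show ?case by (simp add: sin_double)
  next
    case (ge2 n)
    have "sin \<theta> * chebyshev_U (Suc (Suc n)) (cos \<theta>)
      = 2 * cos \<theta> * sin (real (Suc n + 1) * \<theta>) - sin (real (n + 1) * \<theta>)"
      using ge2 by (simp add: algebra_simps)
    also have "real (n + 1) * \<theta> = real (Suc n + 1) * \<theta> - \<theta>"
      by (simp add: algebra_simps)
    also have "2 * cos \<theta> * sin (real (Suc n + 1) * \<theta>) - sin (real (Suc n + 1) * \<theta> - \<theta>)
      = sin (real (Suc n + 1) * \<theta> + \<theta>)"
      by (simp only: sin_add sin_diff) simp
    also have "real (Suc n + 1) * \<theta> + \<theta> = real (Suc (Suc n) + 1) * \<theta>"
      by (simp add: algebra_simps)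
    finally show ?case .
  qed
  then show ?thesis by (simp only: x(2) flip: x(1)) (simp add: \<theta>_def)
qed

text \<open>
  The factor \<open>(-1)\<^bsup>m-t\<^esup> (n - N)\<^sub>m\<^sub>-\<^sub>t\<close> is a falling factorial, hence \<open>(m - t)!\<close> times a binomial
  coefficient, and \<open>(n + 2)\<^sub>m\<^sub>-\<^sub>t\<close> is a quotient of factorials. The resulting expression is
  symmetric in \<open>m\<close> and \<open>n\<close>, which is invisible in the definition.
\<close>

lemma alpha_binomial:
  assumes "t \<le> m" "m \<le> n" "n \<le> N"
  shows "alpha N t m n = real (N + 1 choose t) * real (N + 1 choose (n + m + 1 - t))
    / (real (N choose n) * real (N choose m))"
proof -
  define j where "j = m - t"
  have "pochhammer (real N + 2 - real t) t / fact t = real (N + 1 choose t)"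
  proof -
    have "real N + 2 - real t = real (N + 1) - real t + 1" by simp
    then show ?thesis by (simp only: gbinomial_pochhammer'[symmetric] binomial_gbinomial)
  qed
  moreover have "(- 1) ^ j * pochhammer (real n - real N) j = fact j * real ((N - n) choose j)"
  proof -
    have "real n - real N = - real (N - n)" using assms by simp
    moreover have "real ((N - n) choose j) = (- 1) ^ j * pochhammer (- real (N - n)) j / fact j"
      by (simp only: binomial_gbinomial gbinomial_pochhammer)
    ultimately show ?thesis by (metis fact_nonzero nonzero_mult_div_cancel_left times_divide_eq_right)
  qed
  moreover have "pochhammer (real n + 2) j = fact (n + 1 + j) / fact (n + 1)"
  proof -
    have "fact (n + 1 + j) = (fact (n + 1) :: real) * pochhammer (1 + real (n + 1)) j"
      unfolding pochhammer_fact by (subst pochhammer_product'[symmetric]) simp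
    moreover have "1 + real (n + 1) = real n + 2" by simp
    ultimately show ?thesis by (simp only:) simp
  qed
  moreover have "fact (N - m) * fact m / fact N = 1 / real (N choose m)"
    using assms by (simp add: binomial_fact mult.commute)
  ultimately have alpha: "alpha N t m n = real (N + 1) / real (n + 1) * (1 / real (N choose m))
    * (fact j * real ((N - n) choose j) / (fact (n + 1 + j) / fact (n + 1))) * real (N + 1 choose t)"
    unfolding alpha_def j_def[symmetric] by (simp only: times_divide_eq_right mult.assoc)
  have quotient: "real (N + 1) / real (n + 1)
      * (fact j * real ((N - n) choose j) / (fact (n + 1 + j) / fact (n + 1)))
    = real (N + 1 choose (n + m + 1 - t)) / real (N choose n)"
  proof -
    have k: "n + m + 1 - t = n + 1 + j" using assms by (simp add: j_def)
    have pos: "real (N choose n) > 0" using assms by simp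
    have 1: "real (n + 1) * real (N + 1 choose (n + 1)) = real (N + 1) * real (N choose n)"
      using Suc_times_binomial_eq[of N n] by (metis Suc_eq_plus1 mult.commute of_nat_mult)
    have 2: "real (N + 1 choose (n + 1 + j)) * (fact (n + 1 + j) / (fact (n + 1) * fact j))
      = real (N + 1 choose (n + 1)) * real (N - n choose j)"
    proof (cases "n + 1 + j \<le> N + 1")
      case True
      have "(N + 1 choose (n + 1 + j)) * (n + 1 + j choose (n + 1))
        = (N + 1 choose (n + 1)) * (N - n choose j)"
        using choose_mult[of "n + 1" "n + 1 + j" "N + 1"] True by (simp del: binomial_Suc_Suc)
      moreover have "real (n + 1 + j choose (n + 1)) = fact (n + 1 + j) / (fact (n + 1) * fact j)"
        using binomial_fact[of "n + 1" "n + 1 + j", where 'a = real]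
        by (simp del: binomial_Suc_Suc fact_Suc)
      ultimately show ?thesis by (metis of_nat_mult)
    next
      case False
      then have "N + 1 choose (n + 1 + j) = 0" "N - n choose j = 0"
        using assms by (auto intro!: binomial_eq_0)
      then show ?thesis by (simp only: of_nat_0 mult_zero_left mult_zero_right)
    qed
    have 3: "real (N + 1 choose (n + 1)) > 0" using assms by (simp del: binomial_Suc_Suc)
    have "real (N + 1) / real (n + 1) = real (N + 1 choose (n + 1)) / real (N choose n)"
      using 1 pos by (simp add: field_simps del: binomial_Suc_Suc)
    moreover have "fact j * real ((N - n) choose j) / (fact (n + 1 + j) / fact (n + 1))
      = real (N + 1 choose (n + 1 + j)) / real (N + 1 choose (n + 1))"
      using 2 3 by (simp add: field_simps del: binomial_Suc_Suc fact_Suc)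
    ultimately show ?thesis unfolding k
      using 3 by (simp only:) (simp del: binomial_Suc_Suc)
  qed
  have rearrange: "X * (1 / c) * Y * Z = Z * (X * Y) * (1 / c)" for X c Y Z :: real
    by simp
  show ?thesis
    unfolding alpha rearrange quotient by (simp add: mult_ac del: binomial_Suc_Suc)
qed

text \<open>
  The entry \<open>W(cos \<theta>)\<^sub>a\<^sub>b\<close>. For indices larger than \<open>N\<close> the denominator is \<open>0\<close> and so is the value.
  Such indices occur below with a vanishing factor only.
\<close>

definition trig_weight :: "nat \<Rightarrow> nat \<Rightarrow> nat \<Rightarrow> real \<Rightarrow> real" where
  "trig_weight N a b \<theta> =
     (\<Sum>t\<le>a. sine_term N (a + b + 1) t \<theta>) / (real (N choose a) * real (N choose b))"

definition trig_weight_deriv :: "nat \<Rightarrow> nat \<Rightarrow> nat \<Rightarrow> real \<Rightarrow> real" where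
  "trig_weight_deriv N a b \<theta> =
     (\<Sum>t\<le>a. sine_term_deriv N (a + b + 1) t \<theta>) / (real (N choose a) * real (N choose b))"

lemma has_derivative_trig_weight:
  "(trig_weight N a b has_real_derivative trig_weight_deriv N a b \<theta>) (at \<theta>)"
  unfolding trig_weight_def [abs_def] trig_weight_deriv_def
  by (intro DERIV_cdivide DERIV_sum has_derivative_sine_term)

lemma trig_weight_sym: "trig_weight N a b \<theta> = trig_weight N b a \<theta>"
  using sum_sine_term_swap[of N a b \<theta>] by (simp add: trig_weight_def add.commute mult.commute)

definition weight_entry :: "nat \<Rightarrow> nat \<Rightarrow> nat \<Rightarrow> real \<Rightarrow> real" where
  "weight_entry N a b x = (if b \<le> a then weight_lower N a b x else weight_lower N b a x)"

lemma weight_lower_trig: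
  assumes "m \<le> n" "n \<le> N" "x \<in> {-1..1}"
  shows "weight_lower N n m x = trig_weight N m n (arccos x)"
proof -
  have "weight_lower N n m x
    = (\<Sum>t\<le>m. alpha N t m n * (sqrt (1 - x\<^sup>2) * chebyshev_U (n + m - 2 * t) x))"
    unfolding weight_lower_def sum_distrib_left atLeast0AtMost by (simp only: mult.left_commute)
  also have "\<dots> = (\<Sum>t\<le>m. sine_term N (m + n + 1) t (arccos x)
      / (real (N choose m) * real (N choose n)))"
  proof (intro sum.cong refl)
    fix t assume "t \<in> {..m}"
    then have t: "t \<le> m" by simp
    have "real (n + m - 2 * t + 1) = real (m + n + 1) - 2 * real t"
      using t assms by (simp add: of_nat_diff)
    then show "alpha N t m n * (sqrt (1 - x\<^sup>2) * chebyshev_U (n + m - 2 * t) x)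
      = sine_term N (m + n + 1) t (arccos x) / (real (N choose m) * real (N choose n))"
      using t assms
      by (simp only: chebyshev_U_sin alpha_binomial sine_term_def binomial_pair_def)
        (simp add: add_ac mult_ac del: binomial_Suc_Suc)
  qed
  finally show ?thesis by (simp only: trig_weight_def sum_divide_distrib)
qed

lemma weight_entry_trig:
  assumes "a \<le> N" "b \<le> N" "x \<in> {-1..1}"
  shows "weight_entry N a b x = trig_weight N a b (arccos x)"
  using assms weight_lower_trig[of b a N x] weight_lower_trig[of a b N x]
  by (auto simp: weight_entry_def trig_weight_sym[of N b a])

section \<open>Relations between neighbouring entries of the weight\<close>

text \<open>
  Passing from the denominator of a neighbouring entry to that of \<open>W\<^sub>a\<^sub>b\<close>.
\<close>

lemma exchange_denominator:
  fixes p q y z c S :: real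
  assumes "p * y = q * z" "y \<noteq> 0" "z \<noteq> 0"
  shows "q * (S / (y * c)) = p * S / (z * c)"
proof -
  have "q / y = p / z" using assms by (simp add: frac_eq_eq)
  then have "q / y * (S / c) = p / z * (S / c)" by simp
  then show ?thesis by simp
qed

text \<open>
  In this and the following three lemmas a neighbour of \<open>W\<^sub>a\<^sub>b\<close>, multiplied by the entry of \<open>C\<close> that
  accompanies it, is written over the same denominator as \<open>W\<^sub>a\<^sub>b\<close>. In the boundary case \<open>a = N\<close> the
  left-hand side is \<open>0\<close>; on the right the sum may be taken up to \<open>b\<close> instead, and then each term
  contains a binomial coefficient \<open>N + 1\<close> over a number larger than \<open>N + 1\<close>.
\<close>

lemma raise_first:
  assumes "a \<le> N" "b \<le> N"
  shows "(real N - real a) * trig_weight N (a + 1) b \<theta>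
    = (real a + 1) * (\<Sum>t\<le>a + 1. sine_term N (a + b + 2) t \<theta>)
      / (real (N choose a) * real (N choose b))"
proof (cases "a = N")
  case True
  have "(\<Sum>t\<le>a + 1. sine_term N (a + b + 2) t \<theta>) = (\<Sum>t\<le>b. sine_term N (a + b + 2) t \<theta>)"
    using sum_sine_term_swap[of N "a + 1" b \<theta>] by simp
  also have "\<dots> = 0"
    using True by (intro sum.neutral) (auto simp: sine_term_def binomial_pair_def binomial_eq_0 simp del: binomial_Suc_Suc)
  finally show ?thesis using True by simp
next
  case False
  have "(real a + 1) * real (N choose (a + 1)) = (real N - real a) * real (N choose a)"
    using binomial_absorb_real[of a N] by (simp add: add_ac)
  moreover have "real (N choose (a + 1)) \<noteq> 0" "real (N choose a) \<noteq> 0"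
    using False assms by auto
  ultimately have "(real N - real a) * (S / (real (N choose (a + 1)) * real (N choose b)))
    = (real a + 1) * S / (real (N choose a) * real (N choose b))" for S
    by (rule exchange_denominator)
  moreover have "a + 1 + b + 1 = a + b + 2" by simp
  ultimately show ?thesis
    by (simp only: trig_weight_def)
qed

lemma raise_second:
  assumes "a \<le> N" "b \<le> N"
  shows "(real N - real b) * trig_weight N a (b + 1) \<theta>
    = (real b + 1) * (\<Sum>t\<le>a. sine_term N (a + b + 2) t \<theta>)
      / (real (N choose a) * real (N choose b))"
  using raise_first[of b N a \<theta>] assms sum_sine_term_swap[of N a "b + 1" \<theta>]
  by (simp add: trig_weight_sym[of N a] add_ac mult_ac)

text \<open>
  For \<open>b = 0\<close> the sum on the right runs over an interval that the reflection preserves, so both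
  sides vanish.
\<close>

lemma lower_second:
  assumes "a \<le> N" "b \<le> N"
  shows "real b * trig_weight N a (b - 1) \<theta>
    = (real N + 1 - real b) * (\<Sum>t\<le>a. sine_term N (a + b) t \<theta>)
      / (real (N choose a) * real (N choose b))"
proof (cases b)
  case 0
  then show ?thesis
    using sum_sine_term_symmetric_interval[of 0 a a N \<theta>] by (simp add: atLeast0AtMost)
next
  case (Suc c)
  have "real b * real (N choose b) = (real N + 1 - real b) * real (N choose c)"
    using binomial_absorb_real[of c N] Suc by (simp add: add_ac)
  then have "(real N + 1 - real b) * real (N choose c) = real b * real (N choose b)" by simp
  moreover have "real (N choose c) \<noteq> 0" "real (N choose b) \<noteq> 0"
    using Suc assms by auto
  ultimately have "real b * (S / (real (N choose c) * real (N choose a)))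
    = (real N + 1 - real b) * S / (real (N choose b) * real (N choose a))" for S
    by (rule exchange_denominator)
  moreover have "b - 1 = c" "a + c + 1 = a + b" using Suc by simp_all
  ultimately show ?thesis
    by (simp only: trig_weight_def mult.commute[of "real (N choose a)"])
qed

lemma lower_first:
  assumes "a \<le> N" "b \<le> N"
  shows "real a * trig_weight N (a - 1) b \<theta>
    = (real N + 1 - real a) * (\<Sum>t<a. sine_term N (a + b) t \<theta>)
      / (real (N choose a) * real (N choose b))"
proof (cases a)
  case 0
  then show ?thesis by simp
next
  case (Suc c)
  then show ?thesis
    using lower_second[of b N a \<theta>] assms sum_sine_term_swap[of N c b \<theta>]
    by (simp add: trig_weight_sym[of N c] add_ac mult_ac lessThan_Suc_atMost)
qed
lemma lowering_relation:
  assumes "a \<le> N" "b \<le> N"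
  shows "real a * trig_weight N (a - 1) b \<theta> + real b * trig_weight N a (b - 1) \<theta>
    = - sin \<theta> * trig_weight_deriv N a b \<theta>
      + (real a + real b + 1) * cos \<theta> * trig_weight N a b \<theta>"
  unfolding lower_first[OF assms] lower_second[OF assms]
  unfolding trig_weight_def trig_weight_deriv_def
    times_divide_eq_right add_divide_distrib[symmetric] lower_sum ..

lemma raising_relation:
  assumes "a \<le> N" "b \<le> N"
  shows "(real N - real a) * trig_weight N (a + 1) b \<theta>
      + (real N - real b) * trig_weight N a (b + 1) \<theta>
    = - sin \<theta> * trig_weight_deriv N a b \<theta>
      + (2 * real N + 1 - real a - real b) * cos \<theta> * trig_weight N a b \<theta>"
  unfolding raise_first[OF assms] raise_second[OF assms]
  unfolding trig_weight_def trig_weight_deriv_def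
    times_divide_eq_right add_divide_distrib[symmetric] raise_sum ..

lemma lowering_derivative:
  assumes "a \<le> N" "b \<le> N"
  shows "((\<lambda>\<theta>. real a * trig_weight N (a - 1) b \<theta> - real b * trig_weight N a (b - 1) \<theta>
            - (real a - real b) * cos \<theta> * trig_weight N a b \<theta>)
     has_real_derivative (real a - real b) * (real a + real b + 2) * sin \<theta> * trig_weight N a b \<theta>)
     (at \<theta>)"
proof -
  let ?g = "real (N choose a) * real (N choose b)"
  have "((\<lambda>\<theta>. (real N + 1 - real a) * (\<Sum>t<a. sine_term N (a + b) t \<theta>) / ?g
      - (real N + 1 - real b) * (\<Sum>t\<le>a. sine_term N (a + b) t \<theta>) / ?g
      - (real a - real b) * cos \<theta> * trig_weight N a b \<theta>)
    has_real_derivative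
      (real N + 1 - real a) * (\<Sum>t<a. sine_term_deriv N (a + b) t \<theta>) / ?g
      - (real N + 1 - real b) * (\<Sum>t\<le>a. sine_term_deriv N (a + b) t \<theta>) / ?g
      - ((real a - real b) * - sin \<theta> * trig_weight N a b \<theta>
         + (real a - real b) * cos \<theta> * trig_weight_deriv N a b \<theta>)) (at \<theta>)"
    by (intro DERIV_diff DERIV_cdivide DERIV_cmult DERIV_sum has_derivative_sine_term)
      (auto intro!: derivative_eq_intros has_derivative_trig_weight)
  moreover have "(real N + 1 - real a) * (\<Sum>t<a. sine_term_deriv N (a + b) t \<theta>) / ?g
      - (real N + 1 - real b) * (\<Sum>t\<le>a. sine_term_deriv N (a + b) t \<theta>) / ?g
    = (real a - real b) * ((real a + real b + 1) * sin \<theta> * trig_weight N a b \<theta>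
      + cos \<theta> * trig_weight_deriv N a b \<theta>)"
    unfolding trig_weight_def trig_weight_deriv_def
      times_divide_eq_right add_divide_distrib[symmetric] diff_divide_distrib[symmetric]
      lower_sum_deriv ..
  ultimately show ?thesis
    unfolding lower_first[OF assms] lower_second[OF assms] by (simp only:) (simp add: algebra_simps)
qed

lemma raising_derivative:
  assumes "a \<le> N" "b \<le> N"
  shows "((\<lambda>\<theta>. (real N - real a) * trig_weight N (a + 1) b \<theta>
            - (real N - real b) * trig_weight N a (b + 1) \<theta>
            + (real a - real b) * cos \<theta> * trig_weight N a b \<theta>)
     has_real_derivative
       - (real a - real b) * (2 * real N + 2 - real a - real b) * sin \<theta> * trig_weight N a b \<theta>)
     (at \<theta>)"
proof -
  let ?g = "real (N choose a) * real (N choose b)"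
  have "((\<lambda>\<theta>. (real a + 1) * (\<Sum>t\<le>a + 1. sine_term N (a + b + 2) t \<theta>) / ?g
      - (real b + 1) * (\<Sum>t\<le>a. sine_term N (a + b + 2) t \<theta>) / ?g
      + (real a - real b) * cos \<theta> * trig_weight N a b \<theta>)
    has_real_derivative
      (real a + 1) * (\<Sum>t\<le>a + 1. sine_term_deriv N (a + b + 2) t \<theta>) / ?g
      - (real b + 1) * (\<Sum>t\<le>a. sine_term_deriv N (a + b + 2) t \<theta>) / ?g
      + ((real a - real b) * - sin \<theta> * trig_weight N a b \<theta>
         + (real a - real b) * cos \<theta> * trig_weight_deriv N a b \<theta>)) (at \<theta>)"
    by (intro DERIV_add DERIV_diff DERIV_cdivide DERIV_cmult DERIV_sum has_derivative_sine_term)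
      (auto intro!: derivative_eq_intros has_derivative_trig_weight)
  moreover have "(real a + 1) * (\<Sum>t\<le>a + 1. sine_term_deriv N (a + b + 2) t \<theta>) / ?g
      - (real b + 1) * (\<Sum>t\<le>a. sine_term_deriv N (a + b + 2) t \<theta>) / ?g
    = - (real a - real b) * ((2 * real N + 1 - real a - real b) * sin \<theta> * trig_weight N a b \<theta>
      + cos \<theta> * trig_weight_deriv N a b \<theta>)"
    unfolding trig_weight_def trig_weight_deriv_def
      times_divide_eq_right add_divide_distrib[symmetric] diff_divide_distrib[symmetric]
      raise_sum_deriv ..
  ultimately show ?thesis
    unfolding raise_first[OF assms] raise_second[OF assms] by (simp only:) (simp add: algebra_simps)
qed

section \<open>The relations as differential equations in the variable x\<close>

definition sine_weight :: "nat \<Rightarrow> nat \<Rightarrow> nat \<Rightarrow> real \<Rightarrow> real" where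
  "sine_weight N a b x = trig_weight N a b (arccos x)"

lemma sine_weight_sym: "sine_weight N a b x = sine_weight N b a x"
  by (simp add: sine_weight_def trig_weight_sym)

lemma continuous_on_sine_weight: "continuous_on {-1..1} (sine_weight N a b)"
  unfolding sine_weight_def [abs_def] trig_weight_def sine_term_def divide_inverse
  by (intro continuous_intros) auto

lemma sine_weight_boundary:
  assumes "x \<in> {-1, 1}"
  shows "sine_weight N a b x = 0"
proof -
  have "sine_term N r t (arccos x) = 0" for r t
  proof -
    have "arccos x = 0 \<or> arccos x = pi" using assms by auto
    moreover have "sin (real_of_int (int r - 2 * int t) * pi) = 0"
      by (subst mult.commute) (rule sin_npi_int)
    ultimately show ?thesis by (auto simp: sine_term_def)
  qed
  then show ?thesis by (simp add: sine_weight_def trig_weight_def)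
qed

text \<open>
  The differential relations above produce a factor \<open>sin \<theta>\<close>, which cancels against the derivative
  \<open>-1 / sin \<theta>\<close> of the substitution \<open>\<theta> = arccos x\<close>.
\<close>

lemma has_derivative_arccos_chain:
  assumes F: "(F has_real_derivative F' * sin (arccos x)) (at (arccos x))"
    and x: "x \<in> {-1<..<1}"
    and G: "\<And>y. y \<in> {-1<..<1} \<Longrightarrow> G y = F (arccos y)"
  shows "(G has_real_derivative - F') (at x)"
proof -
  have "sin (arccos x) = sqrt (1 - x\<^sup>2)" using x by (simp add: sin_arccos)
  moreover have "sqrt (1 - x\<^sup>2) > 0" using x by (simp add: abs_square_less_1 abs_less_iff)
  ultimately have "F' * sin (arccos x) * inverse (- sqrt (1 - x\<^sup>2)) = - F'"
    by (simp add: field_simps)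
  moreover have "(arccos has_real_derivative inverse (- sqrt (1 - x\<^sup>2))) (at x)"
    using x by (intro DERIV_arccos) auto
  with F have "((\<lambda>y. F (arccos y)) has_real_derivative
      F' * sin (arccos x) * inverse (- sqrt (1 - x\<^sup>2))) (at x)"
    by (rule DERIV_chain2)
  ultimately have "((\<lambda>y. F (arccos y)) has_real_derivative - F') (at x)"
    by (simp only:)
  then show ?thesis
    by (rule has_field_derivative_transform_within_open[where S = "{-1<..<1}"]) (use x G in auto)
qed

text \<open>
  The entry \<open>(a, b)\<close> of \<open>C W\<close>. As \<open>W\<close> is symmetric, exchanging \<open>a\<close> and \<open>b\<close> gives \<open>W C\<^sup>T\<close>.
\<close>

definition left_neighbours :: "nat \<Rightarrow> nat \<Rightarrow> nat \<Rightarrow> real \<Rightarrow> real" where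
  "left_neighbours N a b x = (real N - real a) * sine_weight N (a + 1) b x + real a * sine_weight N (a - 1) b x"

text \<open>
  This is the matrix equation \<open>2 ((1 - x\<^sup>2) W)' = (C - x U) W + W (C - x U)\<^sup>T\<close>, the sum of the
  lowering and the raising relation.
\<close>

lemma has_derivative_pearson:
  assumes ab: "a \<le> N" "b \<le> N" and x: "x \<in> {-1<..<1}"
  shows "((\<lambda>x. (1 - x\<^sup>2) * sine_weight N a b x) has_real_derivative
    (left_neighbours N a b x + left_neighbours N b a x) / 2 - (real N + 3) * x * sine_weight N a b x) (at x)"
proof -
  let ?\<theta> = "arccos x"
  have x': "cos ?\<theta> = x" using x by auto
  have "((\<lambda>\<theta>. (sin \<theta>)\<^sup>2 * trig_weight N a b \<theta>) has_real_derivative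
    (2 * cos ?\<theta> * trig_weight N a b ?\<theta> + sin ?\<theta> * trig_weight_deriv N a b ?\<theta>) * sin ?\<theta>) (at ?\<theta>)"
    by (auto intro!: derivative_eq_intros has_derivative_trig_weight
      simp: power2_eq_square algebra_simps)
  then have "((\<lambda>x. (1 - x\<^sup>2) * sine_weight N a b x) has_real_derivative
    - (2 * cos ?\<theta> * trig_weight N a b ?\<theta> + sin ?\<theta> * trig_weight_deriv N a b ?\<theta>)) (at x)"
    by (rule has_derivative_arccos_chain[OF _ x])
      (auto simp: sine_weight_def sin_squared_eq)
  moreover have "- (2 * cos ?\<theta> * trig_weight N a b ?\<theta> + sin ?\<theta> * trig_weight_deriv N a b ?\<theta>)
    = (left_neighbours N a b x + left_neighbours N b a x) / 2 - (real N + 3) * x * sine_weight N a b x"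
    using lowering_relation[OF ab, of ?\<theta>] raising_relation[OF ab, of ?\<theta>]
    unfolding left_neighbours_def sine_weight_sym[of N _ a] x'
    by (simp add: sine_weight_def x' algebra_simps)
  ultimately show ?thesis by simp
qed

lemma lowering_derivative_x:
  assumes ab: "a \<le> N" "b \<le> N" and x: "x \<in> {-1<..<1}"
  shows "((\<lambda>x. real a * sine_weight N (a - 1) b x - real b * sine_weight N a (b - 1) x
      - (real a - real b) * x * sine_weight N a b x)
     has_real_derivative - (real a - real b) * (real a + real b + 2) * sine_weight N a b x) (at x)"
proof -
  have *: "((\<lambda>\<theta>. real a * trig_weight N (a - 1) b \<theta> - real b * trig_weight N a (b - 1) \<theta>
            - (real a - real b) * cos \<theta> * trig_weight N a b \<theta>)
     has_real_derivative (real a - real b) * (real a + real b + 2) * sine_weight N a b x * sin (arccos x))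
     (at (arccos x))"
    using lowering_derivative[OF ab, of "arccos x"] by (simp add: sine_weight_def mult_ac)
  have "((\<lambda>x. real a * sine_weight N (a - 1) b x - real b * sine_weight N a (b - 1) x
      - (real a - real b) * x * sine_weight N a b x)
     has_real_derivative - ((real a - real b) * (real a + real b + 2) * sine_weight N a b x)) (at x)"
    by (rule has_derivative_arccos_chain[OF * x]) (simp add: sine_weight_def)
  then show ?thesis by (simp only: mult_minus_left)
qed

lemma raising_derivative_x:
  assumes ab: "a \<le> N" "b \<le> N" and x: "x \<in> {-1<..<1}"
  shows "((\<lambda>x. (real N - real a) * sine_weight N (a + 1) b x - (real N - real b) * sine_weight N a (b + 1) x
      + (real a - real b) * x * sine_weight N a b x)
     has_real_derivative (real a - real b) * (2 * real N + 2 - real a - real b) * sine_weight N a b x) (at x)"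
proof -
  have *: "((\<lambda>\<theta>. (real N - real a) * trig_weight N (a + 1) b \<theta>
            - (real N - real b) * trig_weight N a (b + 1) \<theta>
            + (real a - real b) * cos \<theta> * trig_weight N a b \<theta>)
     has_real_derivative
       - (real a - real b) * (2 * real N + 2 - real a - real b) * sine_weight N a b x * sin (arccos x))
     (at (arccos x))"
    using raising_derivative[OF ab, of "arccos x"] by (simp add: sine_weight_def mult_ac)
  have "((\<lambda>x. (real N - real a) * sine_weight N (a + 1) b x - (real N - real b) * sine_weight N a (b + 1) x
      + (real a - real b) * x * sine_weight N a b x)
     has_real_derivative
       - (- (real a - real b) * (2 * real N + 2 - real a - real b) * sine_weight N a b x)) (at x)"
    by (rule has_derivative_arccos_chain[OF * x]) (simp add: sine_weight_def)
  then show ?thesis by (simp only: mult_minus_left minus_minus)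
qed

text \<open>
  This is the matrix equation \<open>((C W - W C\<^sup>T) / 2)' = - V W + W V\<close>, the sum of the two
  differential relations, in which the terms with \<open>x W\<close> cancel.
\<close>

lemma has_derivative_neighbour_difference:
  assumes ab: "a \<le> N" "b \<le> N" and x: "x \<in> {-1<..<1}"
  shows "((\<lambda>x. (left_neighbours N a b x - left_neighbours N b a x) / 2) has_real_derivative
    (real a * (real N - real a) - real b * (real N - real b)) * sine_weight N a b x) (at x)"
proof -
  have "((\<lambda>x. ((real a * sine_weight N (a - 1) b x - real b * sine_weight N a (b - 1) x
      - (real a - real b) * x * sine_weight N a b x)
    + ((real N - real a) * sine_weight N (a + 1) b x - (real N - real b) * sine_weight N a (b + 1) x
      + (real a - real b) * x * sine_weight N a b x)) / 2) has_real_derivative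
   (- (real a - real b) * (real a + real b + 2) * sine_weight N a b x
    + (real a - real b) * (2 * real N + 2 - real a - real b) * sine_weight N a b x) / 2) (at x)"
    by (intro DERIV_cdivide DERIV_add lowering_derivative_x raising_derivative_x assms)
  moreover have "(- (real a - real b) * (real a + real b + 2) * sine_weight N a b x
    + (real a - real b) * (2 * real N + 2 - real a - real b) * sine_weight N a b x) / 2
    = (real a * (real N - real a) - real b * (real N - real b)) * sine_weight N a b x"
    by (simp add: field_simps)
  moreover have "(\<lambda>x. ((real a * sine_weight N (a - 1) b x - real b * sine_weight N a (b - 1) x
      - (real a - real b) * x * sine_weight N a b x)
    + ((real N - real a) * sine_weight N (a + 1) b x - (real N - real b) * sine_weight N a (b + 1) x
      + (real a - real b) * x * sine_weight N a b x)) / 2)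
    = (\<lambda>x. (left_neighbours N a b x - left_neighbours N b a x) / 2)"
    unfolding left_neighbours_def sine_weight_sym[of N _ a] by (intro ext) (simp add: algebra_simps)
  ultimately show ?thesis
    by (simp only:)
qed

text \<open>
  The entry \<open>(a, b)\<close> of \<open>2 N (B\<^sub>0 + x B\<^sub>1) W\<close>, where \<open>N = 2 \<ell>\<close>.
\<close>

definition first_order_flux :: "nat \<Rightarrow> nat \<Rightarrow> nat \<Rightarrow> real \<Rightarrow> real" where
  "first_order_flux N a b x = real a * sine_weight N (a - 1) b x - (real N - real a) * sine_weight N (a + 1) b x
     + (real N - 2 * real a) * x * sine_weight N a b x"

text \<open>
  The lowering and the raising relation contain the same derivative of \<open>W\<close>. Their difference
  expresses that \<open>(B\<^sub>0 + x B\<^sub>1) W\<close> is antisymmetric.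
\<close>

lemma first_order_flux_antisym:
  assumes ab: "a \<le> N" "b \<le> N" and x: "x \<in> {-1..1}"
  shows "first_order_flux N b a x = - first_order_flux N a b x"
proof -
  have x': "cos (arccos x) = x" using x by auto
  show ?thesis
    using lowering_relation[OF ab, of "arccos x"] raising_relation[OF ab, of "arccos x"]
    unfolding first_order_flux_def sine_weight_sym[of N _ a] x'
    by (simp add: sine_weight_def x' algebra_simps)
qed

text \<open>
  By antisymmetry the flux is half the difference of the entries \<open>(a, b)\<close> and \<open>(b, a)\<close>, which is
  half the difference of the functions in the two differential relations.
\<close>

lemma has_derivative_first_order_flux:
  assumes ab: "a \<le> N" "b \<le> N" and x: "x \<in> {-1<..<1}"
  shows "(first_order_flux N a b has_real_derivative
    - ((real N + 2) * (real a - real b)) * sine_weight N a b x) (at x)"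
proof -
  have "((\<lambda>x. ((real a * sine_weight N (a - 1) b x - real b * sine_weight N a (b - 1) x
      - (real a - real b) * x * sine_weight N a b x)
    - ((real N - real a) * sine_weight N (a + 1) b x - (real N - real b) * sine_weight N a (b + 1) x
      + (real a - real b) * x * sine_weight N a b x)) / 2) has_real_derivative
   (- (real a - real b) * (real a + real b + 2) * sine_weight N a b x
    - (real a - real b) * (2 * real N + 2 - real a - real b) * sine_weight N a b x) / 2) (at x)"
    by (intro DERIV_cdivide DERIV_diff lowering_derivative_x raising_derivative_x assms)
  moreover have "(- (real a - real b) * (real a + real b + 2) * sine_weight N a b x
    - (real a - real b) * (2 * real N + 2 - real a - real b) * sine_weight N a b x) / 2
    = - ((real N + 2) * (real a - real b)) * sine_weight N a b x"
    by (simp add: field_simps)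
  ultimately have deriv: "((\<lambda>x. ((real a * sine_weight N (a - 1) b x - real b * sine_weight N a (b - 1) x
      - (real a - real b) * x * sine_weight N a b x)
    - ((real N - real a) * sine_weight N (a + 1) b x - (real N - real b) * sine_weight N a (b + 1) x
      + (real a - real b) * x * sine_weight N a b x)) / 2) has_real_derivative
    - ((real N + 2) * (real a - real b)) * sine_weight N a b x) (at x)"
    by (simp only:)
  have eq: "((real a * sine_weight N (a - 1) b y - real b * sine_weight N a (b - 1) y
      - (real a - real b) * y * sine_weight N a b y)
    - ((real N - real a) * sine_weight N (a + 1) b y - (real N - real b) * sine_weight N a (b + 1) y
      + (real a - real b) * y * sine_weight N a b y)) / 2 = first_order_flux N a b y"
    if "y \<in> {-1<..<1}" for y
    using first_order_flux_antisym[OF ab, of y] that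
    unfolding first_order_flux_def sine_weight_sym[of N _ a] by (simp add: field_simps)
  show ?thesis
    by (rule has_field_derivative_transform_within_open[OF deriv, where S = "{-1<..<1}"])
      (use x eq in auto)
qed

section \<open>Integration by parts\<close>

abbreviation eval :: "complex poly \<Rightarrow> real \<Rightarrow> complex" where
  "eval p x \<equiv> poly p (complex_of_real x)"

definition integrand :: "nat \<Rightarrow> (nat \<Rightarrow> complex poly) \<Rightarrow> (nat \<Rightarrow> complex poly) \<Rightarrow> real \<Rightarrow> complex" where
  "integrand N p q x =
     (\<Sum>a\<le>N. \<Sum>b\<le>N. eval (p a) x * of_real (sine_weight N a b x) * cnj (eval (q b) x))"

definition pairing :: "nat \<Rightarrow> (nat \<Rightarrow> complex poly) \<Rightarrow> (nat \<Rightarrow> complex poly) \<Rightarrow> complex" where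
  "pairing N p q = integral {-1..1} (integrand N p q)"

lemma continuous_on_integrand: "continuous_on {-1..1} (integrand N p q)"
  unfolding integrand_def [abs_def]
  by (intro continuous_intros continuous_on_sine_weight)

lemma integrand_integrable: "integrand N p q integrable_on {-1..1}"
  by (intro integrable_continuous_real continuous_on_integrand)

definition row_act :: "nat \<Rightarrow> diffop \<Rightarrow> (nat \<Rightarrow> complex poly) \<Rightarrow> nat \<Rightarrow> complex poly" where
  "row_act N Fs p c = (\<Sum>i<length Fs. \<Sum>a\<le>N. (pderiv ^^ i) (p a) * Fs ! i $$ (a, c))"

lemma has_vector_derivative_eval:
  "((\<lambda>x. eval p x) has_vector_derivative eval (pderiv p) x) (at x)"
  using has_vector_derivative_real_field[OF poly_DERIV[of p "complex_of_real x"]] .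

lemma has_vector_derivative_cnj_eval:
  "((\<lambda>x. cnj (eval p x)) has_vector_derivative cnj (eval (pderiv p) x)) (at x)"
  using has_vector_derivative_eval by (rule has_vector_derivative_cnj)

text \<open>
  Moving the coefficients of an operator from the row on the left to the weight.
\<close>

lemma act_integrand_left:
  fixes u0 u1 u2 v :: "nat \<Rightarrow> complex"
  shows "(\<Sum>c\<le>N. \<Sum>b\<le>N. (\<Sum>a\<le>N. u0 a * of_real (f0 a c) + u1 a * of_real (f1 a c) + u2 a * of_real (f2 a c))
      * of_real (w c b) * v b)
    = (\<Sum>a\<le>N. \<Sum>b\<le>N. (u0 a * of_real (\<Sum>c\<le>N. f0 a c * w c b) + u1 a * of_real (\<Sum>c\<le>N. f1 a c * w c b)
         + u2 a * of_real (\<Sum>c\<le>N. f2 a c * w c b)) * v b)"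
proof -
  have "(\<Sum>c\<le>N. \<Sum>b\<le>N. (\<Sum>a\<le>N. u0 a * of_real (f0 a c) + u1 a * of_real (f1 a c) + u2 a * of_real (f2 a c))
      * of_real (w c b) * v b)
    = (\<Sum>c\<le>N. \<Sum>b\<le>N. \<Sum>a\<le>N. (u0 a * of_real (f0 a c) + u1 a * of_real (f1 a c) + u2 a * of_real (f2 a c))
      * of_real (w c b) * v b)"
    by (simp only: sum_distrib_right)
  also have "\<dots> = (\<Sum>a\<le>N. \<Sum>b\<le>N. \<Sum>c\<le>N. (u0 a * of_real (f0 a c) + u1 a * of_real (f1 a c) + u2 a * of_real (f2 a c))
      * of_real (w c b) * v b)"
    by (subst (2) sum.swap, subst sum.swap) (rule sum.cong [OF refl], rule sum.swap)
  also have "\<dots> = (\<Sum>a\<le>N. \<Sum>b\<le>N. (u0 a * of_real (\<Sum>c\<le>N. f0 a c * w c b) + u1 a * of_real (\<Sum>c\<le>N. f1 a c * w c b)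
         + u2 a * of_real (\<Sum>c\<le>N. f2 a c * w c b)) * v b)"
    unfolding of_real_sum of_real_mult sum_distrib_left sum.distrib[symmetric] sum_distrib_right
    by (intro sum.cong refl) (simp add: algebra_simps)
  finally show ?thesis .
qed

text \<open>
  The function \<open>p' G q\<^sup>* - p G q'\<^sup>* + p K q\<^sup>*\<close> is a primitive of the difference of the two
  integrands and vanishes at both end points. The derivatives are required in the open interval only, which
  is why the continuity of \<open>G\<close> and \<open>K\<close> on the closed interval is a separate hypothesis. The operator
  enters through the real functions \<open>f0\<close>, \<open>f1\<close>, \<open>f2\<close> that give the values of its coefficients, so
  that operators of first order are covered by \<open>f2 = 0\<close>.
\<close>

lemma pairing_symmetric_criterion:
  fixes f0 f1 f2 G G' K K' :: "nat \<Rightarrow> nat \<Rightarrow> real \<Rightarrow> real"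
  assumes action: "\<And>p c x. c \<le> N \<Longrightarrow> eval (row_act N Fs p c) x =
      (\<Sum>a\<le>N. eval (p a) x * of_real (f0 a c x) + eval (pderiv (p a)) x * of_real (f1 a c x)
         + eval (pderiv (pderiv (p a))) x * of_real (f2 a c x))"
    and second: "\<And>a b x. a \<le> N \<Longrightarrow> b \<le> N \<Longrightarrow> x \<in> {-1<..<1} \<Longrightarrow>
      (\<Sum>c\<le>N. f2 a c x * sine_weight N c b x) = G a b x"
    and first: "\<And>a b x. a \<le> N \<Longrightarrow> b \<le> N \<Longrightarrow> x \<in> {-1<..<1} \<Longrightarrow>
      (\<Sum>c\<le>N. f1 a c x * sine_weight N c b x) = G' a b x + K a b x"
    and zeroth: "\<And>a b x. a \<le> N \<Longrightarrow> b \<le> N \<Longrightarrow> x \<in> {-1<..<1} \<Longrightarrow>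
      (\<Sum>c\<le>N. f0 a c x * sine_weight N c b x) - (\<Sum>c\<le>N. f0 b c x * sine_weight N c a x) = K' a b x"
    and sym: "\<And>a b x. a \<le> N \<Longrightarrow> b \<le> N \<Longrightarrow> x \<in> {-1<..<1} \<Longrightarrow>
      G b a x = G a b x \<and> G' b a x = G' a b x \<and> K b a x = - K a b x"
    and deriv: "\<And>a b x. a \<le> N \<Longrightarrow> b \<le> N \<Longrightarrow> x \<in> {-1<..<1} \<Longrightarrow>
      (G a b has_real_derivative G' a b x) (at x) \<and> (K a b has_real_derivative K' a b x) (at x)"
    and cont: "\<And>a b. a \<le> N \<Longrightarrow> b \<le> N \<Longrightarrow> continuous_on {-1..1} (G a b) \<and> continuous_on {-1..1} (K a b)"
    and boundary: "\<And>a b x. a \<le> N \<Longrightarrow> b \<le> N \<Longrightarrow> x \<in> {-1, 1} \<Longrightarrow> G a b x = 0 \<and> K a b x = 0"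
  shows "pairing N (row_act N Fs p) q = pairing N p (row_act N Fs q)"
proof -
  define F where "F x = (\<Sum>a\<le>N. \<Sum>b\<le>N.
      eval (pderiv (p a)) x * of_real (G a b x) * cnj (eval (q b) x)
      - eval (p a) x * of_real (G a b x) * cnj (eval (pderiv (q b)) x)
      + eval (p a) x * of_real (K a b x) * cnj (eval (q b) x))" for x
  have F_cont: "continuous_on {-1..1} F"
    unfolding F_def [abs_def] using cont by (intro continuous_intros) auto
  have F_boundary: "F 1 = 0" "F (-1) = 0"
    unfolding F_def using boundary by simp_all
  have "(F has_vector_derivative
      integrand N (row_act N Fs p) q x - integrand N p (row_act N Fs q) x) (at x)"
    if x: "x \<in> {-1<..<1}" for x
  proof -
    let ?u0 = "\<lambda>a. eval (p a) x" and ?u1 = "\<lambda>a. eval (pderiv (p a)) x"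
      and ?u2 = "\<lambda>a. eval (pderiv (pderiv (p a))) x"
      and ?v0 = "\<lambda>a. cnj (eval (q a) x)" and ?v1 = "\<lambda>a. cnj (eval (pderiv (q a)) x)"
      and ?v2 = "\<lambda>a. cnj (eval (pderiv (pderiv (q a))) x)"
    let ?dF = "\<lambda>a b. (?u1 a * of_real (G a b x) * ?v1 b
          + (?u1 a * of_real (G' a b x) + ?u2 a * of_real (G a b x)) * ?v0 b)
        - (?u0 a * of_real (G a b x) * ?v2 b
          + (?u0 a * of_real (G' a b x) + ?u1 a * of_real (G a b x)) * ?v1 b)
        + (?u0 a * of_real (K a b x) * ?v1 b
          + (?u0 a * of_real (K' a b x) + ?u1 a * of_real (K a b x)) * ?v0 b)"
    have "(F has_vector_derivative (\<Sum>a\<le>N. \<Sum>b\<le>N. ?dF a b)) (at x)"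
      unfolding F_def [abs_def]
      by (intro has_vector_derivative_sum has_vector_derivative_add has_vector_derivative_diff
          has_vector_derivative_mult has_vector_derivative_eval has_vector_derivative_cnj_eval
          has_vector_derivative_of_real) (use deriv x in auto)
    moreover have "integrand N (row_act N Fs p) q x
      = (\<Sum>a\<le>N. \<Sum>b\<le>N. (?u0 a * of_real (\<Sum>c\<le>N. f0 a c x * sine_weight N c b x)
        + ?u1 a * of_real (G' a b x + K a b x) + ?u2 a * of_real (G a b x)) * ?v0 b)"
    proof -
      have "integrand N (row_act N Fs p) q x
      = (\<Sum>a\<le>N. \<Sum>b\<le>N. (?u0 a * of_real (\<Sum>c\<le>N. f0 a c x * sine_weight N c b x)
        + ?u1 a * of_real (\<Sum>c\<le>N. f1 a c x * sine_weight N c b x)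
        + ?u2 a * of_real (\<Sum>c\<le>N. f2 a c x * sine_weight N c b x)) * ?v0 b)"
        unfolding integrand_def act_integrand_left[symmetric]
        by (intro sum.cong refl) (simp add: action)
      also have "\<dots> = (\<Sum>a\<le>N. \<Sum>b\<le>N. (?u0 a * of_real (\<Sum>c\<le>N. f0 a c x * sine_weight N c b x)
        + ?u1 a * of_real (G' a b x + K a b x) + ?u2 a * of_real (G a b x)) * ?v0 b)"
        using x by (intro sum.cong refl) (simp only: atMost_iff first second)
      finally show ?thesis .
    qed
    moreover have "integrand N p (row_act N Fs q) x
      = (\<Sum>a\<le>N. \<Sum>b\<le>N. (?v0 b * of_real (\<Sum>c\<le>N. f0 b c x * sine_weight N c a x)
        + ?v1 b * of_real (G' a b x - K a b x) + ?v2 b * of_real (G a b x)) * ?u0 a)"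
    proof -
      have "integrand N p (row_act N Fs q) x
        = (\<Sum>c\<le>N. \<Sum>a\<le>N. cnj (eval (row_act N Fs q c) x) * of_real (sine_weight N c a x) * ?u0 a)"
        unfolding integrand_def by (subst sum.swap) (simp add: sine_weight_sym[of N _ _ x] mult_ac)
      also have "\<dots> = (\<Sum>b\<le>N. \<Sum>a\<le>N. (?v0 b * of_real (\<Sum>c\<le>N. f0 b c x * sine_weight N c a x)
        + ?v1 b * of_real (\<Sum>c\<le>N. f1 b c x * sine_weight N c a x)
        + ?v2 b * of_real (\<Sum>c\<le>N. f2 b c x * sine_weight N c a x)) * ?u0 a)"
        unfolding act_integrand_left[symmetric]
        by (intro sum.cong refl) (simp add: action)
      also have "\<dots> = (\<Sum>a\<le>N. \<Sum>b\<le>N. (?v0 b * of_real (\<Sum>c\<le>N. f0 b c x * sine_weight N c a x)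
        + ?v1 b * of_real (\<Sum>c\<le>N. f1 b c x * sine_weight N c a x)
        + ?v2 b * of_real (\<Sum>c\<le>N. f2 b c x * sine_weight N c a x)) * ?u0 a)"
        by (rule sum.swap)
      also have "\<dots> = (\<Sum>a\<le>N. \<Sum>b\<le>N. (?v0 b * of_real (\<Sum>c\<le>N. f0 b c x * sine_weight N c a x)
        + ?v1 b * of_real (G' a b x - K a b x) + ?v2 b * of_real (G a b x)) * ?u0 a)"
      proof (intro sum.cong refl)
        fix a b assume "a \<in> {..N}" "b \<in> {..N}"
        then have "(\<Sum>c\<le>N. f1 b c x * sine_weight N c a x) = G' a b x - K a b x"
          "(\<Sum>c\<le>N. f2 b c x * sine_weight N c a x) = G a b x"
          using first[of b a x] second[of b a x] sym[of a b x] x by auto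
        then show "(?v0 b * of_real (\<Sum>c\<le>N. f0 b c x * sine_weight N c a x)
            + ?v1 b * of_real (\<Sum>c\<le>N. f1 b c x * sine_weight N c a x)
            + ?v2 b * of_real (\<Sum>c\<le>N. f2 b c x * sine_weight N c a x)) * ?u0 a
          = (?v0 b * of_real (\<Sum>c\<le>N. f0 b c x * sine_weight N c a x)
            + ?v1 b * of_real (G' a b x - K a b x) + ?v2 b * of_real (G a b x)) * ?u0 a"
          by (simp only:)
      qed
      finally show ?thesis .
    qed
    moreover have "(?u0 a * of_real (\<Sum>c\<le>N. f0 a c x * sine_weight N c b x)
        + ?u1 a * of_real (G' a b x + K a b x) + ?u2 a * of_real (G a b x)) * ?v0 b
      - (?v0 b * of_real (\<Sum>c\<le>N. f0 b c x * sine_weight N c a x)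
        + ?v1 b * of_real (G' a b x - K a b x) + ?v2 b * of_real (G a b x)) * ?u0 a = ?dF a b"
      if "a \<le> N" "b \<le> N" for a b
    proof -
      have "(\<Sum>c\<le>N. f0 a c x * sine_weight N c b x) = (\<Sum>c\<le>N. f0 b c x * sine_weight N c a x) + K' a b x"
        using zeroth[OF that x] by simp
      then show ?thesis by (simp only: of_real_add of_real_diff) (simp add: algebra_simps)
    qed
    ultimately show ?thesis by (simp add: sum_subtractf[symmetric])
  qed
  then have "((\<lambda>x. integrand N (row_act N Fs p) q x - integrand N p (row_act N Fs q) x)
      has_integral F 1 - F (-1)) {-1..1}"
    by (intro fundamental_theorem_of_calculus_interior F_cont) auto
  then have "integral {-1..1} (\<lambda>x. integrand N (row_act N Fs p) q x - integrand N p (row_act N Fs q) x) = 0"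
    by (simp add: F_boundary integral_unique)
  then show ?thesis
    by (simp add: pairing_def integral_diff integrand_integrable)
qed

section \<open>Symmetry of the two operators\<close>

lemma sum_diagonal:
  fixes f g :: "nat \<Rightarrow> 'a::semiring_0"
  assumes "a \<le> N"
  shows "(\<Sum>c\<le>N. (if a = c then f c else 0) * g c) = f a * g a"
proof -
  have "(\<Sum>c\<le>N. (if a = c then f c else 0) * g c) = (\<Sum>c\<le>N. if a = c then f c * g c else 0)"
    by (intro sum.cong) auto
  then show ?thesis using assms by simp
qed

lemma sum_off_diagonal:
  fixes a N :: nat and u d :: real
  assumes "a \<le> N" "a = N \<Longrightarrow> u = 0" "a = 0 \<Longrightarrow> d = 0"
  shows "(\<Sum>c\<le>N. (if c = a + 1 then u else if a = c + 1 then d else 0) * w c)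
    = u * w (a + 1) + d * w (a - 1)"
proof -
  have "(\<Sum>c\<le>N. (if c = a + 1 then u else if a = c + 1 then d else 0) * w c)
    = (\<Sum>c\<le>N. (if c = a + 1 then u * w c else 0) + (if c = a - 1 \<and> a > 0 then d * w c else 0))"
    by (intro sum.cong) auto
  also have "\<dots> = u * w (a + 1) + d * w (a - 1)"
    using assms by (cases "a = 0"; cases "a = N") (auto simp: sum.distrib)
  finally show ?thesis .
qed

lemma D_op_entries:
  assumes "a \<le> N" "c \<le> N"
  shows "D_op N ! 0 $$ (a, c) = [:if a = c then of_nat a * (2 * ell N - of_nat a) else 0:]"
    and "D_op N ! 1 $$ (a, c) =
      [:if c = a + 1 then 2 * ell N - of_nat a else if a = c + 1 then of_nat a else 0,
        if a = c then - (2 * ell N + 3) else 0:]"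
    and "D_op N ! 2 $$ (a, c) = [:if a = c then 1 else 0, 0, if a = c then - 1 else 0:]"
  using assms
  by (auto simp: D_op_def const_mat_def V_mat_def C_mat_def U_mat_def diag_of_def off_diag_def
      power2_eq_square one_pCons)

lemma E_op_entries:
  assumes "a \<le> N" "c \<le> N"
  shows "E_op N ! 0 $$ (a, c) =
      [:if a = c then (2 * ell N + 2) * (of_nat a - 2 * ell N) / (- (4 * ell N)) else 0:]"
    and "E_op N ! 1 $$ (a, c) =
      [:if c = a + 1 then - ((2 * ell N - of_nat a) / (4 * ell N))
        else if a = c + 1 then of_nat a / (4 * ell N) else 0,
        if a = c then (ell N - of_nat a) / (2 * ell N) else 0:]"
  using assms
  by (auto simp: E_op_def const_mat_def B0_mat_def B1_mat_def A_mat_def diag_of_def off_diag_def)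

lemma row_act_D_op_expand:
  "row_act N (D_op N) p c = (\<Sum>a\<le>N. p a * D_op N ! 0 $$ (a, c)
     + pderiv (p a) * D_op N ! 1 $$ (a, c) + pderiv (pderiv (p a)) * D_op N ! 2 $$ (a, c))"
proof -
  have "{..<length (D_op N)} = {0, 1, 2}" by (auto simp: D_op_def)
  then show ?thesis
    by (simp add: row_act_def sum.distrib) (simp add: numeral_2_eq_2)
qed

lemma row_act_E_op_expand:
  "row_act N (E_op N) p c
     = (\<Sum>a\<le>N. p a * E_op N ! 0 $$ (a, c) + pderiv (p a) * E_op N ! 1 $$ (a, c))"
proof -
  have "{..<length (E_op N)} = {0, 1}" by (auto simp: E_op_def)
  then show ?thesis by (simp add: row_act_def sum.distrib)
qed

lemma eval_D_op_entries:
  assumes "a \<le> N" "c \<le> N"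
  shows "eval (D_op N ! 0 $$ (a, c)) x = of_real (if a = c then real a * (real N - real a) else 0)"
    and "eval (D_op N ! 1 $$ (a, c)) x = of_real
      ((if c = a + 1 then real N - real a else if a = c + 1 then real a else 0)
        + (if a = c then - (real N + 3) * x else 0))"
    and "eval (D_op N ! 2 $$ (a, c)) x = of_real (if a = c then 1 - x\<^sup>2 else 0)"
  unfolding D_op_entries[OF assms] by (auto simp: power2_eq_square algebra_simps)

lemma eval_E_op_entries:
  assumes "a \<le> N" "c \<le> N"
  shows "eval (E_op N ! 0 $$ (a, c)) x = of_real
      (if a = c then - ((real N + 2) * (real a - real N) / (2 * real N)) else 0)"
    and "eval (E_op N ! 1 $$ (a, c)) x = of_real
      ((if c = a + 1 then - (real N - real a) / (2 * real N)
        else if a = c + 1 then real a / (2 * real N) else 0)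
      + (if a = c then (real N - 2 * real a) * x / (2 * real N) else 0))"
proof -
  show "eval (E_op N ! 0 $$ (a, c)) x = of_real
      (if a = c then - ((real N + 2) * (real a - real N) / (2 * real N)) else 0)"
    unfolding E_op_entries[OF assms] by auto
  have "of_real x * (ell N - of_nat a) / of_nat N
    = ((of_nat N - 2 * of_nat a) * of_real x / (2 * of_nat N) :: complex)"
    by (simp add: field_simps)
  then show "eval (E_op N ! 1 $$ (a, c)) x = of_real
      ((if c = a + 1 then - (real N - real a) / (2 * real N)
        else if a = c + 1 then real a / (2 * real N) else 0)
      + (if a = c then (real N - 2 * real a) * x / (2 * real N) else 0))"
    unfolding E_op_entries[OF assms] by (auto simp: minus_divide_left)
qed

lemma row_act_D_op:
  assumes "c \<le> N"
  shows "eval (row_act N (D_op N) p c) x =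
    (\<Sum>a\<le>N. eval (p a) x * of_real (if a = c then real a * (real N - real a) else 0)
       + eval (pderiv (p a)) x * of_real
           ((if c = a + 1 then real N - real a else if a = c + 1 then real a else 0)
            + (if a = c then - (real N + 3) * x else 0))
       + eval (pderiv (pderiv (p a))) x * of_real (if a = c then 1 - x\<^sup>2 else 0))"
  unfolding row_act_D_op_expand poly_sum poly_add poly_mult
  using assms by (intro sum.cong refl) (simp only: eval_D_op_entries atMost_iff)

lemma row_act_E_op:
  assumes "c \<le> N"
  shows "eval (row_act N (E_op N) p c) x =
    (\<Sum>a\<le>N. eval (p a) x * of_real
           (if a = c then - ((real N + 2) * (real a - real N) / (2 * real N)) else 0)
       + eval (pderiv (p a)) x * of_real
           ((if c = a + 1 then - (real N - real a) / (2 * real N)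
             else if a = c + 1 then real a / (2 * real N) else 0)
            + (if a = c then (real N - 2 * real a) * x / (2 * real N) else 0))
       + eval (pderiv (pderiv (p a))) x * of_real 0)"
  unfolding row_act_E_op_expand poly_sum poly_add poly_mult of_real_0 mult_zero_right add_0_right
  using assms by (intro sum.cong refl) (simp only: eval_E_op_entries atMost_iff)

text \<open>
  Here \<open>G = (1 - x\<^sup>2) W\<close> and \<open>K = (C W - W C\<^sup>T) / 2\<close>: the scalar matrix \<open>U\<close> contributes to the
  symmetric part of \<open>F\<^sub>1 W\<close> only.
\<close>

lemma pairing_symmetric_D_op: "pairing N (row_act N (D_op N) p) q = pairing N p (row_act N (D_op N) q)"
proof (rule pairing_symmetric_criterion[OF row_act_D_op, where
      G = "\<lambda>a b x. (1 - x\<^sup>2) * sine_weight N a b x" and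
      G' = "\<lambda>a b x. (left_neighbours N a b x + left_neighbours N b a x) / 2
        - (real N + 3) * x * sine_weight N a b x" and
      K = "\<lambda>a b x. (left_neighbours N a b x - left_neighbours N b a x) / 2" and
      K' = "\<lambda>a b x. (real a * (real N - real a) - real b * (real N - real b)) * sine_weight N a b x"])
  fix a b :: nat and x :: real
  assume ab: "a \<le> N" "b \<le> N"
  show "(\<Sum>c\<le>N. (if a = c then 1 - x\<^sup>2 else 0) * sine_weight N c b x) = (1 - x\<^sup>2) * sine_weight N a b x"
    using ab sum_diagonal[of a N "\<lambda>_. 1 - x\<^sup>2"] by simp
  show "(\<Sum>c\<le>N. ((if c = a + 1 then real N - real a else if a = c + 1 then real a else 0)
          + (if a = c then - (real N + 3) * x else 0)) * sine_weight N c b x)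
    = (left_neighbours N a b x + left_neighbours N b a x) / 2 - (real N + 3) * x * sine_weight N a b x
      + (left_neighbours N a b x - left_neighbours N b a x) / 2"
    unfolding distrib_right sum.distrib
    using ab sum_diagonal[of a N "\<lambda>_. - (real N + 3) * x" "\<lambda>c. sine_weight N c b x"]
      sum_off_diagonal[of a N "real N - real a" "real a" "\<lambda>c. sine_weight N c b x"]
    by (simp add: left_neighbours_def field_simps)
  show "(\<Sum>c\<le>N. (if a = c then real a * (real N - real a) else 0) * sine_weight N c b x)
      - (\<Sum>c\<le>N. (if b = c then real b * (real N - real b) else 0) * sine_weight N c a x)
    = (real a * (real N - real a) - real b * (real N - real b)) * sine_weight N a b x"
    using ab sum_diagonal[of a N "\<lambda>_. real a * (real N - real a)" "\<lambda>c. sine_weight N c b x"]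
      sum_diagonal[of b N "\<lambda>_. real b * (real N - real b)" "\<lambda>c. sine_weight N c a x"]
    by (simp add: sine_weight_sym[of N b a] algebra_simps)
  show "(1 - x\<^sup>2) * sine_weight N b a x = (1 - x\<^sup>2) * sine_weight N a b x \<and>
    (left_neighbours N b a x + left_neighbours N a b x) / 2 - (real N + 3) * x * sine_weight N b a x
      = (left_neighbours N a b x + left_neighbours N b a x) / 2 - (real N + 3) * x * sine_weight N a b x \<and>
    (left_neighbours N b a x - left_neighbours N a b x) / 2
      = - ((left_neighbours N a b x - left_neighbours N b a x) / 2)"
    by (simp add: sine_weight_sym[of N b a] add.commute field_simps)
  show "continuous_on {-1..1} (\<lambda>x. (1 - x\<^sup>2) * sine_weight N a b x) \<and>
    continuous_on {-1..1} (\<lambda>x. (left_neighbours N a b x - left_neighbours N b a x) / 2)"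
    unfolding left_neighbours_def by (intro conjI continuous_intros continuous_on_sine_weight) auto
  show "(1 - x\<^sup>2) * sine_weight N a b x = 0 \<and> (left_neighbours N a b x - left_neighbours N b a x) / 2 = 0"
    if "x \<in> {-1, 1}"
    using that by (simp add: left_neighbours_def sine_weight_boundary)
  show "((\<lambda>x. (1 - x\<^sup>2) * sine_weight N a b x) has_real_derivative
      (left_neighbours N a b x + left_neighbours N b a x) / 2 - (real N + 3) * x * sine_weight N a b x) (at x) \<and>
    ((\<lambda>x. (left_neighbours N a b x - left_neighbours N b a x) / 2) has_real_derivative
      (real a * (real N - real a) - real b * (real N - real b)) * sine_weight N a b x) (at x)"
    if "x \<in> {-1<..<1}"
    by (intro conjI has_derivative_pearson has_derivative_neighbour_difference ab that)
qed

text \<open>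
  Without a second-order term \<open>G\<close> is \<open>0\<close>, so \<open>F\<^sub>1 W\<close> itself has to be antisymmetric.
\<close>

lemma pairing_symmetric_E_op:
  assumes "N > 0"
  shows "pairing N (row_act N (E_op N) p) q = pairing N p (row_act N (E_op N) q)"
proof (rule pairing_symmetric_criterion[OF row_act_E_op, where
      G = "\<lambda>a b x. 0" and G' = "\<lambda>a b x. 0" and
      K = "\<lambda>a b x. first_order_flux N a b x / (2 * real N)" and
      K' = "\<lambda>a b x. - ((real N + 2) * (real a - real b)) * sine_weight N a b x / (2 * real N)"])
  fix a b :: nat and x :: real
  assume ab: "a \<le> N" "b \<le> N"
  show "(\<Sum>c\<le>N. 0 * sine_weight N c b x) = 0" by simp
  show "(\<Sum>c\<le>N. ((if c = a + 1 then - (real N - real a) / (2 * real N)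
            else if a = c + 1 then real a / (2 * real N) else 0)
          + (if a = c then (real N - 2 * real a) * x / (2 * real N) else 0)) * sine_weight N c b x)
    = 0 + first_order_flux N a b x / (2 * real N)"
    unfolding distrib_right sum.distrib
    using ab sum_diagonal[of a N "\<lambda>_. (real N - 2 * real a) * x / (2 * real N)" "\<lambda>c. sine_weight N c b x"]
      sum_off_diagonal[of a N "- (real N - real a) / (2 * real N)" "real a / (2 * real N)"
        "\<lambda>c. sine_weight N c b x"]
    by (simp add: first_order_flux_def)
      (simp add: algebra_simps add_divide_distrib diff_divide_distrib)
  show "(\<Sum>c\<le>N. (if a = c then - ((real N + 2) * (real a - real N) / (2 * real N)) else 0)
        * sine_weight N c b x)
      - (\<Sum>c\<le>N. (if b = c then - ((real N + 2) * (real b - real N) / (2 * real N)) else 0)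
        * sine_weight N c a x)
    = - ((real N + 2) * (real a - real b)) * sine_weight N a b x / (2 * real N)"
    using ab assms
      sum_diagonal[of a N "\<lambda>_. - ((real N + 2) * (real a - real N) / (2 * real N))" "\<lambda>c. sine_weight N c b x"]
      sum_diagonal[of b N "\<lambda>_. - ((real N + 2) * (real b - real N) / (2 * real N))" "\<lambda>c. sine_weight N c a x"]
    by (simp add: sine_weight_sym[of N b a]) (simp add: field_simps)
  show "(0::real) = 0 \<and> (0::real) = 0 \<and>
    first_order_flux N b a x / (2 * real N) = - (first_order_flux N a b x / (2 * real N))"
    if "x \<in> {-1<..<1}"
    using first_order_flux_antisym[OF ab, of x] that by simp
  show "((\<lambda>x. 0) has_real_derivative 0) (at x) \<and>
    ((\<lambda>x. first_order_flux N a b x / (2 * real N)) has_real_derivative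
      - ((real N + 2) * (real a - real b)) * sine_weight N a b x / (2 * real N)) (at x)"
    if "x \<in> {-1<..<1}"
    by (intro conjI DERIV_const DERIV_cdivide has_derivative_first_order_flux ab that)
  show "continuous_on {-1..1} (\<lambda>x. 0::real) \<and>
    continuous_on {-1..1} (\<lambda>x. first_order_flux N a b x / (2 * real N))"
    unfolding first_order_flux_def using assms
    by (intro conjI continuous_intros continuous_on_sine_weight) auto
  show "0 = (0::real) \<and> first_order_flux N a b x / (2 * real N) = 0"
    if "x \<in> {-1, 1}"
    using that by (simp add: first_order_flux_def sine_weight_boundary)
qed

section \<open>Nondegeneracy of the pairing\<close>

fun chebyshev_U_poly :: "nat \<Rightarrow> complex poly" where
  "chebyshev_U_poly 0 = 1"
| "chebyshev_U_poly (Suc 0) = [:0, 2:]"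
| "chebyshev_U_poly (Suc (Suc n)) = [:0, 2:] * chebyshev_U_poly (Suc n) - chebyshev_U_poly n"

lemma eval_chebyshev_U_poly: "eval (chebyshev_U_poly n) x = of_real (chebyshev_U n x)"
  by (induction n rule: chebyshev_U_poly.induct) (auto simp: algebra_simps)

lemma coeff_chebyshev_U_poly:
  "degree (chebyshev_U_poly n) \<le> n \<and> coeff (chebyshev_U_poly n) n = 2 ^ n"
proof (induction n rule: chebyshev_U_poly.induct)
  case (3 n)
  have "degree ([:0, 2:] * chebyshev_U_poly (Suc n)) \<le> 1 + Suc n"
    using 3 by (intro order.trans[OF degree_mult_le] add_mono) auto
  moreover have "coeff ([:0, 2:] * chebyshev_U_poly (Suc n)) (Suc (Suc n)) = 2 ^ Suc (Suc n)"
    using 3 by simp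
  moreover have "coeff (chebyshev_U_poly n) (Suc (Suc n)) = 0"
    using 3 by (intro coeff_eq_0) linarith
  ultimately show ?case
    using 3 by (auto intro!: degree_diff_le)
qed auto

definition weight_poly_lower :: "nat \<Rightarrow> nat \<Rightarrow> nat \<Rightarrow> complex poly" where
  "weight_poly_lower N n m =
     (\<Sum>t\<le>m. smult (of_real (alpha N t m n)) (chebyshev_U_poly (n + m - 2 * t)))"

definition weight_poly :: "nat \<Rightarrow> nat \<Rightarrow> nat \<Rightarrow> complex poly" where
  "weight_poly N a b = (if b \<le> a then weight_poly_lower N a b else weight_poly_lower N b a)"

lemma sine_weight_eq_weight_poly:
  assumes "a \<le> N" "b \<le> N" "x \<in> {-1..1}"
  shows "of_real (sine_weight N a b x) = of_real (sqrt (1 - x\<^sup>2)) * eval (weight_poly N a b) x"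
proof -
  have lower: "of_real (weight_lower N n m x) = of_real (sqrt (1 - x\<^sup>2)) * eval (weight_poly_lower N n m) x"
    for n m
    by (simp add: weight_lower_def weight_poly_lower_def poly_sum eval_chebyshev_U_poly atLeast0AtMost)
  have "sine_weight N a b x = weight_entry N a b x"
    using weight_entry_trig[OF assms] by (simp add: sine_weight_def)
  then show ?thesis by (simp add: weight_entry_def weight_poly_def lower)
qed

text \<open>
  Only the term \<open>t = 0\<close> reaches the degree \<open>n + m\<close>.
\<close>

lemma coeff_weight_poly_lower:
  assumes "m \<le> n" "n \<le> N"
  shows "degree (weight_poly_lower N n m) \<le> n + m"
    and "coeff (weight_poly_lower N n m) (n + m) =
      2 ^ (n + m) * of_nat (N + 1 choose (n + m + 1)) / (of_nat (N choose n) * of_nat (N choose m))"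
proof -
  show "degree (weight_poly_lower N n m) \<le> n + m"
    unfolding weight_poly_lower_def
  proof (intro degree_sum_le finite_atMost)
    fix t
    show "degree (smult (complex_of_real (alpha N t m n)) (chebyshev_U_poly (n + m - 2 * t))) \<le> n + m"
      using coeff_chebyshev_U_poly[of "n + m - 2 * t"] degree_smult_le
      by (meson diff_le_self order.trans)
  qed
  have "coeff (weight_poly_lower N n m) (n + m)
    = (\<Sum>t\<le>m. of_real (alpha N t m n) * coeff (chebyshev_U_poly (n + m - 2 * t)) (n + m))"
    by (simp add: weight_poly_lower_def coeff_sum)
  also have "\<dots> = (\<Sum>t\<le>m. if t = 0 then of_real (alpha N 0 m n) * 2 ^ (n + m) else 0)"
  proof (intro sum.cong refl)
    fix t assume "t \<in> {..m}"
    show "of_real (alpha N t m n) * coeff (chebyshev_U_poly (n + m - 2 * t)) (n + m)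
      = (if t = 0 then complex_of_real (alpha N 0 m n) * 2 ^ (n + m) else 0)"
    proof (cases "t = 0")
      case True
      then show ?thesis by (simp add: coeff_chebyshev_U_poly)
    next
      case False
      with \<open>t \<in> {..m}\<close> have "n + m - 2 * t < n + m" by simp
      then have "coeff (chebyshev_U_poly (n + m - 2 * t)) (n + m) = 0"
        using coeff_chebyshev_U_poly[of "n + m - 2 * t"] by (intro coeff_eq_0) linarith
      then show ?thesis using False by simp
    qed
  qed
  also have "\<dots> = of_real (alpha N 0 m n) * 2 ^ (n + m)" by simp
  also have "alpha N 0 m n = real (N + 1 choose (n + m + 1)) / (real (N choose n) * real (N choose m))"
    using assms by (subst alpha_binomial) auto
  finally show "coeff (weight_poly_lower N n m) (n + m) =
      2 ^ (n + m) * of_nat (N + 1 choose (n + m + 1)) / (of_nat (N choose n) * of_nat (N choose m))"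
    by (simp del: binomial_Suc_Suc)
qed

lemma coeff_weight_poly:
  assumes "a \<le> N" "b \<le> N"
  shows "degree (weight_poly N a b) \<le> a + b"
    and "coeff (weight_poly N a b) (a + b) = 0 \<longleftrightarrow> a + b > N"
proof -
  have *: "degree (weight_poly_lower N n m) \<le> n + m"
    "coeff (weight_poly_lower N n m) (n + m) = 0 \<longleftrightarrow> n + m > N" if "m \<le> n" "n \<le> N" for n m
    using that by (auto simp: coeff_weight_poly_lower simp del: binomial_Suc_Suc)
  show "degree (weight_poly N a b) \<le> a + b"
    and "coeff (weight_poly N a b) (a + b) = 0 \<longleftrightarrow> a + b > N"
    using *[of b a] *[of a b] assms by (auto simp: weight_poly_def add.commute)
qed

lemma coeff_mult_top:
  fixes p q :: "'a::idom poly"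
  assumes "degree p \<le> i" "degree q \<le> j"
  shows "coeff (p * q) (i + j) = coeff p i * coeff q j"
proof (cases "degree p = i \<and> degree q = j")
  case True
  then show ?thesis using coeff_mult_degree_sum[of p q] by simp
next
  case False
  then have "degree p < i \<or> degree q < j" using assms by linarith
  moreover from this have "degree (p * q) < i + j"
    using assms degree_mult_le[of p q] by linarith
  ultimately show ?thesis by (auto simp: coeff_eq_0)
qed

text \<open>
  Let \<open>D\<close> be the maximum of \<open>degree (p a) + a\<close> over the indices \<open>a\<close> with \<open>p a \<noteq> 0\<close>, and
  let \<open>n\<close> be the smallest index at which \<open>D\<close> is attained. In the component
  \<open>b = N - n\<close> of the product, the coefficient of \<open>x\<^bsup>D+b\<^esup>\<close> receives no contribution from \<open>a < n\<close>,
  where \<open>D\<close> is not attained, and none from \<open>a > n\<close>, where \<open>a + b > N\<close>. The contribution of \<open>n\<close> is not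
  \<open>0\<close>.
\<close>

lemma weight_poly_nonsingular:
  assumes zero: "\<And>b. b \<le> N \<Longrightarrow> (\<Sum>a\<le>N. p a * weight_poly N a b) = 0"
    and "a \<le> N"
  shows "p a = 0"
proof (rule ccontr)
  assume "p a \<noteq> 0"
  define S where "S = {a. a \<le> N \<and> p a \<noteq> 0}"
  define D where "D = Max ((\<lambda>a. degree (p a) + a) ` S)"
  define n where "n = (LEAST a. a \<in> S \<and> degree (p a) + a = D)"
  have "finite S" "S \<noteq> {}" using \<open>p a \<noteq> 0\<close> \<open>a \<le> N\<close> by (auto simp: S_def)
  then have "D \<in> (\<lambda>a. degree (p a) + a) ` S" unfolding D_def by (intro Max_in) auto
  then obtain k where "k \<in> S \<and> degree (p k) + k = D" by blast
  then have n: "n \<in> S \<and> degree (p n) + n = D" unfolding n_def by (rule LeastI)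
  have least: "degree (p a) + a \<noteq> D" if "a \<in> S" "a < n" for a
    using not_less_Least[of a] that unfolding n_def by blast
  have D: "degree (p a) + a \<le> D" if "a \<in> S" for a
    unfolding D_def using that \<open>finite S\<close> by (intro Max_ge) auto
  \<comment> \<open>The last column in which row \<open>n\<close> of the matrix of top coefficients is nonzero.\<close>
  define b where "b = N - n"
  have b: "b \<le> N" "n + b = N" using n by (auto simp: b_def S_def)
  have "coeff (p a * weight_poly N a b) (D + b) = 0" if a: "a \<le> N" "a \<noteq> n" for a
  proof (cases "a \<in> S")
    case True
    have "coeff (p a * weight_poly N a b) ((D - a) + (a + b))
      = coeff (p a) (D - a) * coeff (weight_poly N a b) (a + b)"
      using coeff_weight_poly[of a N b] a b D[OF True] by (intro coeff_mult_top) auto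
    moreover have "coeff (p a) (D - a) * coeff (weight_poly N a b) (a + b) = 0"
    proof (cases "a < n")
      case True
      then have "degree (p a) < D - a" using D[OF \<open>a \<in> S\<close>] least[OF \<open>a \<in> S\<close>] by linarith
      then show ?thesis by (simp add: coeff_eq_0)
    next
      case False
      then show ?thesis using coeff_weight_poly[of a N b] a b by auto
    qed
    moreover have "(D - a) + (a + b) = D + b" using D[OF True] by simp
    ultimately show ?thesis by simp
  next
    case False
    then show ?thesis using a by (simp add: S_def)
  qed
  then have "coeff (\<Sum>a\<le>N. p a * weight_poly N a b) (D + b) = coeff (p n * weight_poly N n b) (D + b)"
    using n by (subst sum.remove[of _ n]) (auto simp: S_def coeff_sum)
  also have "D + b = degree (p n) + (n + b)" using n by simp
  also have "coeff (p n * weight_poly N n b) (degree (p n) + (n + b))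
    = coeff (p n) (degree (p n)) * coeff (weight_poly N n b) (n + b)"
    using coeff_weight_poly[of n N b] n b by (intro coeff_mult_top) (auto simp: S_def)
  also have "\<dots> \<noteq> 0"
    using n b coeff_weight_poly[of n N b] by (auto simp: S_def)
  finally show False using zero[OF b(1)] by simp
qed

text \<open>
  For \<open>q = p w\<close> the integrand is \<open>sqrt (1 - x\<^sup>2)\<close> times the squared norm of the row \<open>p w\<close>. It is
  continuous and nonnegative with integral \<open>0\<close>, hence \<open>p w = 0\<close>.
\<close>

lemma pairing_nondegenerate:
  assumes zero: "\<And>q. pairing N p q = 0" and "a \<le> N"
  shows "p a = 0"
proof -
  define r where "r b = (\<Sum>a\<le>N. p a * weight_poly N a b)" for b
  define g where "g x = sqrt (1 - x\<^sup>2) * (\<Sum>b\<le>N. (cmod (eval (r b) x))\<^sup>2)" for x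
  have g: "integrand N p r x = of_real (g x)" if "x \<in> {-1..1}" for x
  proof -
    have "integrand N p r x
      = (\<Sum>b\<le>N. (\<Sum>a\<le>N. eval (p a) x * of_real (sine_weight N a b x)) * cnj (eval (r b) x))"
      unfolding integrand_def sum_distrib_right by (rule sum.swap)
    also have "\<dots> = (\<Sum>b\<le>N. of_real (sqrt (1 - x\<^sup>2)) * (eval (r b) x * cnj (eval (r b) x)))"
    proof (intro sum.cong refl)
      fix b assume "b \<in> {..N}"
      then have "(\<Sum>a\<le>N. eval (p a) x * of_real (sine_weight N a b x))
        = of_real (sqrt (1 - x\<^sup>2)) * eval (r b) x"
        unfolding r_def poly_sum poly_mult sum_distrib_left
        using that by (intro sum.cong refl) (simp add: sine_weight_eq_weight_poly)
      then show "(\<Sum>a\<le>N. eval (p a) x * of_real (sine_weight N a b x)) * cnj (eval (r b) x)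
        = of_real (sqrt (1 - x\<^sup>2)) * (eval (r b) x * cnj (eval (r b) x))"
        by simp
    qed
    also have "\<dots> = of_real (g x)"
      by (simp add: g_def complex_norm_square[symmetric] sum_distrib_left)
    finally show ?thesis .
  qed
  have "(integrand N p r has_integral 0) {-1..1}"
    using integrable_integral[OF integrand_integrable, of N p r] zero[of r] by (simp add: pairing_def)
  then have "((\<lambda>x. Re (integrand N p r x)) has_integral Re 0) {-1..1}"
    by (rule has_integral_Re)
  then have int: "(g has_integral 0) (cbox (-1) 1)"
    by (subst has_integral_cong[where g = "\<lambda>x. Re (integrand N p r x)"]) (auto simp: g)
  have cont: "continuous_on (cbox (-1) 1) g"
    unfolding g_def [abs_def] by (intro continuous_intros)
  have pos: "\<And>x. x \<in> box (-1) 1 \<Longrightarrow> g x \<ge> 0"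
    unfolding g_def by (intro mult_nonneg_nonneg sum_nonneg) (auto simp: abs_square_le_1 abs_le_iff)
  have g_zero: "g x = 0" if "x \<in> {-1<..<1}" for x
    by (rule has_integral_0_cbox_imp_0[OF cont pos int]) (use that in auto)
  have roots: "eval (r b) x = 0" if "b \<le> N" "x \<in> {-1<..<1}" for b x
  proof -
    have "x\<^sup>2 < 1" using that by (simp add: abs_square_less_1 abs_less_iff)
    moreover have "g x = 0" using that by (intro g_zero)
    ultimately have "(\<Sum>b\<le>N. (cmod (eval (r b) x))\<^sup>2) = 0" by (simp add: g_def)
    then show ?thesis using that by (subst (asm) sum_nonneg_eq_0_iff) auto
  qed
  have "r b = 0" if "b \<le> N" for b
  proof (rule ccontr)
    assume "r b \<noteq> 0"
    then have "finite {z. poly (r b) z = 0}" by (rule poly_roots_finite)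
    moreover have "complex_of_real ` {-1<..<1} \<subseteq> {z. poly (r b) z = 0}"
      using roots[OF that] by auto
    ultimately have "finite (complex_of_real ` {-1<..<1})" by (rule rev_finite_subset)
    then have "finite {-1<..<(1::real)}" by (rule finite_imageD) (simp add: inj_on_def)
    then show False using infinite_Ioo[of "- 1" "1 :: real"] by simp
  qed
  then show ?thesis
    using weight_poly_nonsingular[of N p a] \<open>a \<le> N\<close> by (simp add: r_def)
qed

section \<open>Symmetric operators and monic orthogonal rows\<close>

lemma pairing_cong:
  assumes "\<And>a. a \<le> N \<Longrightarrow> p a = p' a" "\<And>a. a \<le> N \<Longrightarrow> q a = q' a"
  shows "pairing N p q = pairing N p' q'"
proof -
  have "integrand N p q x = integrand N p' q' x" for x
    unfolding integrand_def using assms by (intro sum.cong refl) simp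
  then have "integrand N p q = integrand N p' q'" ..
  then show ?thesis by (simp only: pairing_def)
qed

lemma pairing_add_left: "pairing N (\<lambda>a. p a + p' a) q = pairing N p q + pairing N p' q"
proof -
  have "integrand N (\<lambda>a. p a + p' a) q = (\<lambda>x. integrand N p q x + integrand N p' q x)"
    by (simp add: integrand_def distrib_right sum.distrib fun_eq_iff)
  then show ?thesis by (simp add: pairing_def integral_add integrand_integrable)
qed

lemma pairing_smult_left: "pairing N (\<lambda>a. smult c (p a)) q = c * pairing N p q"
proof -
  have "integrand N (\<lambda>a. smult c (p a)) q = (\<lambda>x. c * integrand N p q x)"
    by (simp add: integrand_def sum_distrib_left mult.assoc fun_eq_iff)
  then show ?thesis by (simp add: pairing_def integrand_integrable)
qed

lemma pairing_cnj: "pairing N q p = cnj (pairing N p q)"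
proof -
  have "integrand N q p x = cnj (integrand N p q x)" for x
  proof -
    have "cnj (integrand N p q x)
      = (\<Sum>a\<le>N. \<Sum>b\<le>N. eval (q b) x * of_real (sine_weight N b a x) * cnj (eval (p a) x))"
      by (simp add: integrand_def sine_weight_sym[of N _ _ x] mult_ac)
    also have "\<dots> = integrand N q p x" unfolding integrand_def by (rule sum.swap)
    finally show ?thesis ..
  qed
  then have "integrand N q p = (\<lambda>x. cnj (integrand N p q x))" ..
  then show ?thesis by (simp add: pairing_def integral_cnj)
qed

lemma higher_pderiv_add: "(pderiv ^^ i) (p + q) = (pderiv ^^ i) p + (pderiv ^^ i) (q :: complex poly)"
  by (induction i) (simp_all add: pderiv_add)

lemma higher_pderiv_smult: "(pderiv ^^ i) (smult c p) = smult c ((pderiv ^^ i) (p :: complex poly))"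
  by (induction i) (simp_all add: pderiv_smult)

lemma row_act_add: "row_act N Fs (\<lambda>a. p a + q a) c = row_act N Fs p c + row_act N Fs q c"
  by (simp add: row_act_def higher_pderiv_add distrib_right sum.distrib)

lemma row_act_smult: "row_act N Fs (\<lambda>a. smult z (p a)) c = smult z (row_act N Fs p c)"
proof -
  have "smult z (sum f A) = (\<Sum>x\<in>A. smult z (f x))" for f :: "nat \<Rightarrow> complex poly" and A
    by (induction A rule: infinite_finite_induct) (simp_all add: smult_add_right)
  then show ?thesis by (simp add: row_act_def higher_pderiv_smult)
qed

lemma row_act_cong:
  assumes "\<And>a. a \<le> N \<Longrightarrow> p a = q a"
  shows "row_act N Fs p c = row_act N Fs q c"
  unfolding row_act_def using assms by (intro sum.cong refl) simp

text \<open>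
  Stated through coefficients so that \<open>n = 0\<close> describes the zero row; the constant \<open>degree\<close> does not
  distinguish the zero polynomial from other constants.
\<close>

definition degree_below :: "nat \<Rightarrow> nat \<Rightarrow> (nat \<Rightarrow> complex poly) \<Rightarrow> bool" where
  "degree_below N n p \<longleftrightarrow> (\<forall>a\<le>N. \<forall>k\<ge>n. coeff (p a) k = 0)"

lemma degree_below_mono: "degree_below N m p \<Longrightarrow> m \<le> n \<Longrightarrow> degree_below N n p"
  by (auto simp: degree_below_def)

lemma degree_below_exists: "\<exists>n. degree_below N n p"
proof (intro exI)
  show "degree_below N (Suc (\<Sum>a\<le>N. degree (p a))) p"
    unfolding degree_below_def
  proof (intro allI impI)
    fix a k assume "a \<le> N" "Suc (\<Sum>a\<le>N. degree (p a)) \<le> k"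
    moreover have "degree (p a) \<le> (\<Sum>a\<le>N. degree (p a))"
      using \<open>a \<le> N\<close> by (intro member_le_sum) auto
    ultimately show "coeff (p a) k = 0" by (intro coeff_eq_0) simp
  qed
qed

text \<open>
  The argument \<open>R n i\<close> is row \<open>i\<close> of the monic orthogonal polynomial of degree \<open>n\<close>.
\<close>

locale monic_orthogonal_rows =
  fixes N :: nat and R :: "nat \<Rightarrow> nat \<Rightarrow> nat \<Rightarrow> complex poly"
  assumes degree_below_R: "i \<le> N \<Longrightarrow> degree_below N (Suc n) (R n i)"
    and lead_R: "i \<le> N \<Longrightarrow> a \<le> N \<Longrightarrow> coeff (R n i a) n = (if i = a then 1 else 0)"
    and orth_R: "m \<noteq> n \<Longrightarrow> i \<le> N \<Longrightarrow> j \<le> N \<Longrightarrow> pairing N (R m i) (R n j) = 0"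
begin

text \<open>
  The rows \<open>R m i\<close> with \<open>m < n\<close> span the rows of degree less than \<open>n\<close>: subtracting the combination
  of the \<open>R n i\<close> whose scalars are the coefficients of \<open>x\<^sup>n\<close> lowers the degree. Compatibility with
  scalars is demanded in the weak form stated here so that the lemma applies to maps that are linear
  and to maps that are conjugate linear.
\<close>

lemma additive_vanishes:
  fixes L :: "(nat \<Rightarrow> complex poly) \<Rightarrow> 'b::ab_group_add"
  assumes add: "\<And>p q. L (\<lambda>a. p a + q a) = L p + L q"
    and smult: "\<And>c p. L p = 0 \<Longrightarrow> L (\<lambda>a. smult c (p a)) = 0"
    and cong: "\<And>p q. (\<And>a. a \<le> N \<Longrightarrow> p a = q a) \<Longrightarrow> L p = L q"
    and rows: "\<And>m i. m < n \<Longrightarrow> i \<le> N \<Longrightarrow> L (R m i) = 0"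
    and "degree_below N n q"
  shows "L q = 0"
  using rows \<open>degree_below N n q\<close>
proof (induction n arbitrary: q)
  have zero: "L (\<lambda>a. 0) = 0"
    using add[of "\<lambda>a. 0" "\<lambda>a. 0"] by simp
  {
    case 0
    then have "q a = 0" if "a \<le> N" for a
      using that by (intro poly_eqI) (simp add: degree_below_def)
    then have "L q = L (\<lambda>a. 0)" by (rule cong)
    then show ?case using zero by simp
  next
    case (Suc n)
    note rows = Suc.prems(1)
    \<comment> \<open>The part of \<open>q\<close> carried by the first \<open>k\<close> rows of degree \<open>n\<close>; \<open>top (Suc N)\<close> has the same
      coefficients of \<open>x\<^sup>n\<close> as \<open>q\<close>.\<close>
    define top where "top k a = (\<Sum>i<k. smult (coeff (q i) n) (R n i a))" for k a
    have top: "L (top k) = 0" if "k \<le> Suc N" for k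
      using that
    proof (induction k)
      case 0
      then show ?case using zero by (simp add: top_def [abs_def])
    next
      case (Suc k)
      have "L (\<lambda>a. top k a + smult (coeff (q k) n) (R n k a)) = 0"
        unfolding add using Suc.prems Suc.IH by (simp add: smult rows)
      then show ?case by (simp add: top_def [abs_def])
    qed
    have rest: "degree_below N n (\<lambda>a. q a - top (Suc N) a)"
      unfolding degree_below_def
    proof (intro allI impI)
      fix a k assume a: "a \<le> N" and k: "n \<le> k"
      show "coeff (q a - top (Suc N) a) k = 0"
      proof (cases "k = n")
        case True
        have "coeff (top (Suc N) a) n = (\<Sum>i<Suc N. if i = a then coeff (q i) n else 0)"
          unfolding top_def coeff_sum coeff_smult
          using a by (intro sum.cong refl) (simp add: lead_R)
        also have "\<dots> = coeff (q a) n" using a by (simp del: sum.lessThan_Suc)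
        finally show ?thesis using True by simp
      next
        case False
        have "coeff (top (Suc N) a) k = (\<Sum>i<Suc N. coeff (q i) n * 0)"
          unfolding top_def coeff_sum coeff_smult
          using a k False degree_below_R by (intro sum.cong refl) (auto simp: degree_below_def)
        moreover have "coeff (q a) k = 0"
          using Suc.prems a k False by (auto simp: degree_below_def)
        ultimately show ?thesis by simp
      qed
    qed
    have "L (\<lambda>a. q a - top (Suc N) a) = 0"
      by (rule Suc.IH[OF _ rest]) (rule Suc.prems(1), simp_all)
    then have "L (\<lambda>a. (q a - top (Suc N) a) + top (Suc N) a) = 0"
      unfolding add using top[of "Suc N"] by simp
    then show ?case by simp
  }
qed

lemma pairing_below_zero:
  assumes "degree_below N n q" "j \<le> N"
  shows "pairing N q (R n j) = 0"
  by (rule additive_vanishes[OF _ _ _ _ assms(1), of "\<lambda>q. pairing N q (R n j)"])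
    (auto simp: pairing_add_left pairing_smult_left orth_R assms(2) intro: pairing_cong)

text \<open>
  The difference \<open>r\<close> of both sides is orthogonal to \<open>R m j\<close> for \<open>m \<ge> n\<close> because its degree is less
  than \<open>n\<close>, and for \<open>m < n\<close> because the operator can be moved to \<open>R m j\<close>, where it does not raise
  the degree. So \<open>r\<close> is in the radical of the pairing.
\<close>

lemma eigenrow:
  assumes sym: "\<And>p q. pairing N (row_act N Fs p) q = pairing N p (row_act N Fs q)"
    and degree: "\<And>p m. degree_below N m p \<Longrightarrow> degree_below N m (row_act N Fs p)"
    and lead: "degree_below N n (\<lambda>a. row_act N Fs (R n i) a - smult ev (R n i a))"
    and i: "i \<le> N" and c: "c \<le> N"
  shows "row_act N Fs (R n i) c = smult ev (R n i c)"
proof -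
  define r where "r a = row_act N Fs (R n i) a - smult ev (R n i a)" for a
  have r: "r = (\<lambda>a. row_act N Fs (R n i) a + smult (- ev) (R n i a))"
    by (simp add: r_def [abs_def])
  have basis: "pairing N r (R m j) = 0" if j: "j \<le> N" for m j
  proof (cases "n \<le> m")
    case True
    then show ?thesis
      using lead j by (intro pairing_below_zero degree_below_mono[of N n r m]) (auto simp: r_def [abs_def])
  next
    case False
    have "pairing N r (R m j) = pairing N (row_act N Fs (R n i)) (R m j) - ev * pairing N (R n i) (R m j)"
      unfolding r pairing_add_left pairing_smult_left by simp
    also have "pairing N (R n i) (R m j) = 0" using False i j by (intro orth_R) auto
    also have "pairing N (row_act N Fs (R n i)) (R m j) = cnj (pairing N (row_act N Fs (R m j)) (R n i))"
      by (simp only: sym pairing_cnj[of N "R n i"])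
    also have "pairing N (row_act N Fs (R m j)) (R n i) = 0"
      using False i j degree[OF degree_below_R[OF j], of m]
      by (intro pairing_below_zero degree_below_mono[of N "Suc m" _ n]) auto
    finally show ?thesis by simp
  qed
  have "pairing N q r = 0" for q
  proof -
    obtain M where "degree_below N M q" using degree_below_exists by blast
    then show ?thesis
      by (rule additive_vanishes[rotated -1, of M q "\<lambda>q. pairing N q r"])
        (auto simp: pairing_add_left pairing_smult_left pairing_cnj[of N _ r] basis intro: pairing_cong)
  qed
  then have "pairing N r q = 0" for q by (simp add: pairing_cnj[of N r])
  then have "r c = 0" using c by (rule pairing_nondegenerate)
  then show ?thesis by (simp add: r_def)
qed

text \<open>
  On each \<open>R n i\<close> both compositions are multiplication by the product of the two scalars.
\<close>

lemma commute_rows: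
  assumes D: "\<And>n i c. i \<le> N \<Longrightarrow> c \<le> N \<Longrightarrow> row_act N Fs (R n i) c = smult (ev n i) (R n i c)"
    and E: "\<And>n i c. i \<le> N \<Longrightarrow> c \<le> N \<Longrightarrow> row_act N Gs (R n i) c = smult (ev' n i) (R n i c)"
    and c: "c \<le> N"
  shows "row_act N Gs (row_act N Fs p) c = row_act N Fs (row_act N Gs p) c"
proof -
  define L where "L p = row_act N Gs (row_act N Fs p) c - row_act N Fs (row_act N Gs p) c" for p
  have add: "L (\<lambda>a. p a + q a) = L p + L q" for p q
    unfolding L_def row_act_add [abs_def] row_act_add by simp
  have smult: "L (\<lambda>a. smult z (p a)) = smult z (L p)" for z p
    unfolding L_def row_act_smult [abs_def] row_act_smult by (simp add: smult_diff_right)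
  have cong: "L p = L q" if "\<And>a. a \<le> N \<Longrightarrow> p a = q a" for p q
    unfolding L_def by (intro arg_cong2[where f = minus] row_act_cong that)
  have rows: "L (R n i) = 0" if "i \<le> N" for n i
  proof -
    have "row_act N Gs (row_act N Fs (R n i)) c = row_act N Gs (\<lambda>a. smult (ev n i) (R n i a)) c"
      using that D by (intro row_act_cong) auto
    moreover have "row_act N Fs (row_act N Gs (R n i)) c
      = row_act N Fs (\<lambda>a. smult (ev' n i) (R n i a)) c"
      using that E by (intro row_act_cong) auto
    ultimately show ?thesis
      using that c by (simp add: L_def row_act_smult D E mult.commute)
  qed
  obtain M where "degree_below N M p" using degree_below_exists by blast
  then have "L p = 0"
    by (rule additive_vanishes[rotated -1, of M p L]) (auto simp: add smult rows intro: cong)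
  then show ?thesis by (simp add: L_def)
qed

end

section \<open>Action on leading coefficients\<close>

definition eigenvalue_D :: "nat \<Rightarrow> nat \<Rightarrow> nat \<Rightarrow> complex" where
  "eigenvalue_D N n i = - (of_nat n * (of_nat n - 1)) - of_nat n * (2 * ell N + 3)
     + of_nat i * (2 * ell N - of_nat i)"

definition eigenvalue_E :: "nat \<Rightarrow> nat \<Rightarrow> nat \<Rightarrow> complex" where
  "eigenvalue_E N n i = of_nat n * (ell N - of_nat i) / (2 * ell N)
     - (2 * ell N + 2) * (of_nat i - 2 * ell N) / (4 * ell N)"

lemma coeff_mult_const: "coeff (p * [:u:]) k = coeff p k * (u :: complex)"
  by (simp add: mult.commute)

lemma coeff_pderiv_mult_linear:
  fixes p :: "complex poly"
  shows "coeff (pderiv p * [:u, v:]) k = of_nat (Suc k) * coeff p (Suc k) * u + of_nat k * coeff p k * v"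
  by (cases k) (simp_all add: coeff_pderiv algebra_simps)

lemma coeff_pderiv2_mult_quadratic:
  fixes p :: "complex poly"
  shows "coeff (pderiv (pderiv p) * [:u, 0, v:]) k =
     of_nat (Suc k) * of_nat (Suc (Suc k)) * coeff p (Suc (Suc k)) * u
     + of_nat k * (of_nat k - 1) * coeff p k * v"
proof (cases k)
  case (Suc j)
  then show ?thesis by (cases j) (simp_all add: coeff_pderiv algebra_simps)
qed (simp add: coeff_pderiv algebra_simps)

text \<open>
  For entries of degree at most \<open>k\<close>, only the part of degree \<open>i\<close> in the coefficient of the \<open>i\<close>-th
  derivative contributes to \<open>x\<^sup>k\<close>, and these parts of the operator are diagonal. The off-diagonal
  matrix \<open>C\<close> comes with a derivative and no factor \<open>x\<close>, so it lowers the degree.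
\<close>

lemma coeff_row_act_D_op:
  assumes "degree_below N (Suc k) p" "c \<le> N"
  shows "coeff (row_act N (D_op N) p c) k = eigenvalue_D N k c * coeff (p c) k"
proof -
  have "coeff (row_act N (D_op N) p c) k
    = (\<Sum>a\<le>N. if a = c then eigenvalue_D N k c * coeff (p c) k else 0)"
    unfolding row_act_D_op_expand coeff_sum
  proof (intro sum.cong refl)
    fix a assume "a \<in> {..N}"
    then have a: "a \<le> N" by simp
    have "coeff (p a) (Suc k) = 0" "coeff (p a) (Suc (Suc k)) = 0"
      using assms a by (auto simp: degree_below_def)
    then show "coeff (p a * D_op N ! 0 $$ (a, c)
      + pderiv (p a) * D_op N ! 1 $$ (a, c) + pderiv (pderiv (p a)) * D_op N ! 2 $$ (a, c)) k
      = (if a = c then eigenvalue_D N k c * coeff (p c) k else 0)"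
      unfolding D_op_entries[OF a assms(2)] coeff_add coeff_mult_const coeff_pderiv_mult_linear
        coeff_pderiv2_mult_quadratic
      by (simp add: eigenvalue_D_def algebra_simps)
  qed
  then show ?thesis using assms by simp
qed

lemma coeff_row_act_E_op:
  assumes "degree_below N (Suc k) p" "c \<le> N"
  shows "coeff (row_act N (E_op N) p c) k = eigenvalue_E N k c * coeff (p c) k"
proof -
  have "coeff (row_act N (E_op N) p c) k
    = (\<Sum>a\<le>N. if a = c then eigenvalue_E N k c * coeff (p c) k else 0)"
    unfolding row_act_E_op_expand coeff_sum
  proof (intro sum.cong refl)
    fix a assume "a \<in> {..N}"
    then have a: "a \<le> N" by simp
    have "coeff (p a) (Suc k) = 0" using assms a by (auto simp: degree_below_def)
    then show "coeff (p a * E_op N ! 0 $$ (a, c) + pderiv (p a) * E_op N ! 1 $$ (a, c)) k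
      = (if a = c then eigenvalue_E N k c * coeff (p c) k else 0)"
      unfolding E_op_entries[OF a assms(2)] coeff_add coeff_mult_const coeff_pderiv_mult_linear
      by (simp add: eigenvalue_E_def algebra_simps)
  qed
  then show ?thesis using assms by simp
qed

lemma degree_below_row_act:
  assumes top: "\<And>k p c. degree_below N (Suc k) p \<Longrightarrow> c \<le> N \<Longrightarrow>
      coeff (row_act N Fs p c) k = ev k c * coeff (p c) k"
    and "degree_below N m p"
  shows "degree_below N m (row_act N Fs p)"
  unfolding degree_below_def
proof (intro allI impI)
  fix c k assume "c \<le> N" "m \<le> k"
  moreover from this have "degree_below N (Suc k) p" using assms(2) by (auto simp: degree_below_def)
  ultimately show "coeff (row_act N Fs p c) k = 0"
    using assms(2) by (simp add: top degree_below_def)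
qed

text \<open>
  The diagonal action on leading coefficients supplies both degree hypotheses of the lemma
  \<open>eigenrow\<close>.
\<close>

lemma (in monic_orthogonal_rows) eigenrow_top:
  assumes sym: "\<And>p q. pairing N (row_act N Fs p) q = pairing N p (row_act N Fs q)"
    and top: "\<And>k p c. degree_below N (Suc k) p \<Longrightarrow> c \<le> N \<Longrightarrow>
      coeff (row_act N Fs p c) k = ev k c * coeff (p c) k"
    and i: "i \<le> N" and c: "c \<le> N"
  shows "row_act N Fs (R n i) c = smult (ev n i) (R n i c)"
proof (rule eigenrow[OF sym degree_below_row_act[OF top] _ i c])
  show "degree_below N n (\<lambda>a. row_act N Fs (R n i) a - smult (ev n i) (R n i a))"
    unfolding degree_below_def
  proof (intro allI impI)
    fix a k assume a: "a \<le> N" and "n \<le> k"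
    then have "degree_below N (Suc k) (R n i)" using degree_below_R[OF i, of n] by (auto simp: degree_below_def)
    then have eq: "coeff (row_act N Fs (R n i) a) k = ev k a * coeff (R n i a) k"
      using a by (rule top)
    show "coeff (row_act N Fs (R n i) a - smult (ev n i) (R n i a)) k = 0"
    proof (cases "k = n")
      case True
      then show ?thesis using eq a i by (simp add: lead_R)
    next
      case False
      then have "coeff (R n i a) k = 0"
        using degree_below_R[OF i, of n] a \<open>n \<le> k\<close> by (auto simp: degree_below_def)
      then show ?thesis using eq by simp
    qed
  qed
qed

section \<open>From rows to matrices\<close>

definition mat_row :: "complex poly mat \<Rightarrow> nat \<Rightarrow> nat \<Rightarrow> complex poly" where
  "mat_row P i a = P $$ (i, a)"

lemma higher_pderiv_mat:
  assumes "P \<in> matpolys N"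
  shows "(map_mat pderiv ^^ k) P \<in> matpolys N \<and>
    (\<forall>i\<le>N. \<forall>a\<le>N. (map_mat pderiv ^^ k) P $$ (i, a) = (pderiv ^^ k) (P $$ (i, a)))"
  using assms by (induction k) auto

lemma act_row:
  assumes P: "P \<in> matpolys N" and Fs: "\<And>i. i < length Fs \<Longrightarrow> Fs ! i \<in> matpolys N"
  shows "P \<lhd>\<^sub>D Fs \<in> matpolys N"
    and "i \<le> N \<Longrightarrow> c \<le> N \<Longrightarrow> mat_row (P \<lhd>\<^sub>D Fs) i c = row_act N Fs (mat_row P i) c"
proof -
  show "P \<lhd>\<^sub>D Fs \<in> matpolys N" using P by (simp add: act_def)
  assume i: "i \<le> N" and c: "c \<le> N"
  have "mat_row (P \<lhd>\<^sub>D Fs) i c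
    = (\<Sum>k<length Fs. ((map_mat pderiv ^^ k) P * Fs ! k) $$ (i, c))"
    using P i c by (simp add: mat_row_def act_def)
  also have "\<dots> = row_act N Fs (mat_row P i) c"
    unfolding row_act_def
  proof (intro sum.cong refl)
    fix k assume "k \<in> {..<length Fs}"
    then have F: "Fs ! k \<in> matpolys N" using Fs by simp
    have "((map_mat pderiv ^^ k) P * Fs ! k) $$ (i, c)
      = (\<Sum>a = 0..<N + 1. (map_mat pderiv ^^ k) P $$ (i, a) * Fs ! k $$ (a, c))"
      using higher_pderiv_mat[OF P, of k] F i c by (auto simp: scalar_prod_def)
    also have "{0..<N + 1} = {..N}" by auto
    finally show "((map_mat pderiv ^^ k) P * Fs ! k) $$ (i, c)
      = (\<Sum>a\<le>N. (pderiv ^^ k) (mat_row P i a) * Fs ! k $$ (a, c))"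
      using higher_pderiv_mat[OF P, of k] i by (simp add: mat_row_def)
  qed
  finally show "mat_row (P \<lhd>\<^sub>D Fs) i c = row_act N Fs (mat_row P i) c" .
qed

lemma D_op_carrier: "k < length (D_op N) \<Longrightarrow> D_op N ! k \<in> matpolys N"
  by (auto simp: D_op_def less_Suc_eq const_mat_def V_mat_def C_mat_def U_mat_def diag_of_def
      off_diag_def numeral_2_eq_2 nth_Cons')

lemma E_op_carrier: "k < length (E_op N) \<Longrightarrow> E_op N ! k \<in> matpolys N"
  by (auto simp: E_op_def less_Suc_eq const_mat_def B0_mat_def B1_mat_def A_mat_def diag_of_def
      off_diag_def)

lemma matpolys_eqI:
  assumes "P \<in> matpolys N" "Q \<in> matpolys N"
    and "\<And>i c. i \<le> N \<Longrightarrow> c \<le> N \<Longrightarrow> mat_row P i c = mat_row Q i c"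
  shows "P = Q"
  using assms by (intro eq_matI) (auto simp: mat_row_def)

text \<open>
  The integrands agree on the whole interval by the trigonometric formula for the weight.
\<close>

lemma inner_W_row:
  assumes P: "P \<in> matpolys N" and Q: "Q \<in> matpolys N" and ij: "i \<le> N" "j \<le> N"
  shows "inner_W N P Q $$ (i, j) = pairing N (mat_row P i) (mat_row Q j)"
proof -
  have "(eval_mat P x * weight N x * mat_adjoint (eval_mat Q x)) $$ (i, j)
    = integrand N (mat_row P i) (mat_row Q j) x" if x: "x \<in> {-1..1}" for x
  proof -
    have W: "weight N x \<in> carrier_mat (N + 1) (N + 1)" by (simp add: weight_def)
    have PW: "(eval_mat P x * weight N x) $$ (i, b)
      = (\<Sum>a\<le>N. eval (mat_row P i a) x * of_real (sine_weight N a b x))" if b: "b \<le> N" for b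
    proof -
      have "(eval_mat P x * weight N x) $$ (i, b)
        = (\<Sum>a = 0..<N + 1. eval_mat P x $$ (i, a) * weight N x $$ (a, b))"
        using P ij b W by (auto simp: eval_mat_def scalar_prod_def)
      also have "{0..<N + 1} = {..N}" by auto
      also have "(\<Sum>a\<le>N. eval_mat P x $$ (i, a) * weight N x $$ (a, b))
        = (\<Sum>a\<le>N. eval (mat_row P i a) x * of_real (sine_weight N a b x))"
      proof (intro sum.cong refl)
        fix a assume "a \<in> {..N}"
        then have a: "a \<le> N" by simp
        have "weight N x $$ (a, b) = of_real (weight_entry N a b x)"
          using a b by (simp add: weight_def weight_entry_def)
        then show "eval_mat P x $$ (i, a) * weight N x $$ (a, b)
          = eval (mat_row P i a) x * of_real (sine_weight N a b x)"
          using P ij a weight_entry_trig[OF a b x] by (simp add: eval_mat_def mat_row_def sine_weight_def)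
      qed
      finally show ?thesis .
    qed
    have "(eval_mat P x * weight N x * mat_adjoint (eval_mat Q x)) $$ (i, j)
      = (\<Sum>b = 0..<N + 1. (eval_mat P x * weight N x) $$ (i, b) * mat_adjoint (eval_mat Q x) $$ (b, j))"
      using P Q ij W by (auto simp: eval_mat_def scalar_prod_def mat_adjoint_def mat_of_rows_def)
    also have "{0..<N + 1} = {..N}" by auto
    also have "(\<Sum>b\<le>N. (eval_mat P x * weight N x) $$ (i, b) * mat_adjoint (eval_mat Q x) $$ (b, j))
      = (\<Sum>b\<le>N. (\<Sum>a\<le>N. eval (mat_row P i a) x * of_real (sine_weight N a b x)) * cnj (eval (mat_row Q j b) x))"
    proof (intro sum.cong refl)
      fix b assume "b \<in> {..N}"
      then have b: "b \<le> N" by simp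
      have "mat_adjoint (eval_mat Q x) $$ (b, j) = cnj (eval (mat_row Q j b) x)"
        using Q b ij by (simp add: mat_adjoint_def mat_of_rows_def eval_mat_def mat_row_def)
      then show "(eval_mat P x * weight N x) $$ (i, b) * mat_adjoint (eval_mat Q x) $$ (b, j)
        = (\<Sum>a\<le>N. eval (mat_row P i a) x * of_real (sine_weight N a b x)) * cnj (eval (mat_row Q j b) x)"
        by (simp only: PW[OF b])
    qed
    also have "\<dots> = integrand N (mat_row P i) (mat_row Q j) x"
      unfolding integrand_def sum_distrib_right by (rule sum.swap)
    finally show ?thesis .
  qed
  then show ?thesis
    using ij unfolding inner_W_def pairing_def by (auto intro!: integral_cong)
qed

lemma symmetric_W_rows:
  assumes Fs: "\<And>i. i < length Fs \<Longrightarrow> Fs ! i \<in> matpolys N"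
    and sym: "\<And>p q. pairing N (row_act N Fs p) q = pairing N p (row_act N Fs q)"
  shows "symmetric_W N Fs"
  unfolding symmetric_W_def
proof (intro ballI)
  fix P Q assume P: "P \<in> matpolys N" and Q: "Q \<in> matpolys N"
  have "inner_W N (P \<lhd>\<^sub>D Fs) Q $$ (i, j) = inner_W N P (Q \<lhd>\<^sub>D Fs) $$ (i, j)"
    if "i \<le> N" "j \<le> N" for i j
  proof -
    have "pairing N (mat_row (P \<lhd>\<^sub>D Fs) i) (mat_row Q j)
      = pairing N (row_act N Fs (mat_row P i)) (mat_row Q j)"
      using that P Fs by (intro pairing_cong) (simp_all add: act_row)
    also have "\<dots> = pairing N (mat_row P i) (row_act N Fs (mat_row Q j))" by (rule sym)
    also have "\<dots> = pairing N (mat_row P i) (mat_row (Q \<lhd>\<^sub>D Fs) j)"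
      using that Q Fs by (intro pairing_cong) (simp_all add: act_row)
    finally show ?thesis
      by (simp only: inner_W_row[OF act_row(1)[OF P Fs] Q that]
          inner_W_row[OF P act_row(1)[OF Q Fs] that])
  qed
  then show "inner_W N (P \<lhd>\<^sub>D Fs) Q = inner_W N P (Q \<lhd>\<^sub>D Fs)"
    by (intro eq_matI) (auto simp: inner_W_def)
qed

lemma monic_orthogonal_rows_mat_row:
  assumes "monic_orthogonal_polys N P"
  shows "monic_orthogonal_rows N (\<lambda>n. mat_row (P n))"
proof
  have P: "P n \<in> matpolys N" for n
    using assms by (simp add: monic_orthogonal_polys_def monic_of_degree_def)
  {
    fix i n assume "i \<le> N"
    then have degree: "degree (P n $$ (i, a)) \<le> n" if "a \<le> N" for a
      using assms that by (simp add: monic_orthogonal_polys_def monic_of_degree_def)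
    show "degree_below N (Suc n) (mat_row (P n) i)"
      unfolding degree_below_def mat_row_def
    proof (intro allI impI coeff_eq_0)
      fix a k assume "a \<le> N" "Suc n \<le> k"
      then show "degree (P n $$ (i, a)) < k" using degree[of a] by linarith
    qed
  next
    fix i a n assume ia: "i \<le> N" "a \<le> N"
    have "map_mat (\<lambda>p. coeff p n) (P n) $$ (i, a) = 1\<^sub>m (N + 1) $$ (i, a)"
      using assms by (simp add: monic_orthogonal_polys_def monic_of_degree_def)
    then show "coeff (mat_row (P n) i a) n = (if i = a then 1 else 0)"
      using P[of n] ia by (auto simp: mat_row_def)
  next
    fix m n i j :: nat assume "m \<noteq> n" and ij: "i \<le> N" "j \<le> N"
    then have "inner_W N (P m) (P n) $$ (i, j) = 0"
      using assms by (simp add: monic_orthogonal_polys_def)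
    then show "pairing N (mat_row (P m) i) (mat_row (P n) j) = 0"
      using P ij by (simp add: inner_W_row)
  }
qed

lemma mat_row_diag_mult:
  assumes "P \<in> matpolys N" "i \<le> N" "c \<le> N"
  shows "mat_row (const_mat (diag_of N f) * P) i c = smult (f i) (mat_row P i c)"
proof -
  have "mat_row (const_mat (diag_of N f) * P) i c
    = (\<Sum>a = 0..<N + 1. const_mat (diag_of N f) $$ (i, a) * P $$ (a, c))"
    using assms by (auto simp: mat_row_def const_mat_def diag_of_def scalar_prod_def)
  also have "{0..<N + 1} = {..N}" by auto
  also have "(\<Sum>a\<le>N. const_mat (diag_of N f) $$ (i, a) * P $$ (a, c))
    = (\<Sum>a\<le>N. if i = a then smult (f i) (P $$ (i, c)) else 0)"
    using assms by (intro sum.cong refl) (auto simp: const_mat_def diag_of_def)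
  also have "\<dots> = smult (f i) (mat_row P i c)" using assms by (simp add: mat_row_def)
  finally show "mat_row (const_mat (diag_of N f) * P) i c = smult (f i) (mat_row P i c)" .
qed

lemma eigenmatrix:
  assumes P: "P \<in> matpolys N" and Fs: "\<And>i. i < length Fs \<Longrightarrow> Fs ! i \<in> matpolys N"
    and rows: "\<And>i c. i \<le> N \<Longrightarrow> c \<le> N \<Longrightarrow> row_act N Fs (mat_row P i) c = smult (f i) (mat_row P i c)"
  shows "P \<lhd>\<^sub>D Fs = const_mat (diag_of N f) * P"
proof (rule matpolys_eqI)
  show "P \<lhd>\<^sub>D Fs \<in> matpolys N" using P Fs by (rule act_row(1))
  show "const_mat (diag_of N f) * P \<in> matpolys N"
    using P by (auto simp: const_mat_def diag_of_def)
  fix i c assume i: "i \<le> N" and c: "c \<le> N"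
  show "mat_row (P \<lhd>\<^sub>D Fs) i c = mat_row (const_mat (diag_of N f) * P) i c"
    by (simp only: act_row(2)[OF P Fs i c] rows[OF i c] mat_row_diag_mult[OF P i c])
qed

theorem theorem3p1:
  fixes N :: nat and P :: "nat \<Rightarrow> complex poly mat"
  assumes "monic_orthogonal_polys N P"
  shows "(\<forall>n. P n \<lhd>\<^sub>D D_op N = const_mat (Lambda_D N n) * P n)
    \<and> symmetric_W N (D_op N)
    \<and> (N > 0 \<longrightarrow>
        (\<forall>n. P n \<lhd>\<^sub>D E_op N = const_mat (Lambda_E N n) * P n)
        \<and> diffops_commute N (D_op N) (E_op N)
        \<and> symmetric_W N (E_op N))"
proof -
  interpret monic_orthogonal_rows N "\<lambda>n. mat_row (P n)"
    using assms by (rule monic_orthogonal_rows_mat_row)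
  have P: "P n \<in> matpolys N" for n
    using assms by (simp add: monic_orthogonal_polys_def monic_of_degree_def)
  have D: "row_act N (D_op N) (mat_row (P n) i) c = smult (eigenvalue_D N n i) (mat_row (P n) i c)"
    if "i \<le> N" "c \<le> N" for n i c
    using pairing_symmetric_D_op coeff_row_act_D_op that by (rule eigenrow_top)
  have "P n \<lhd>\<^sub>D D_op N = const_mat (Lambda_D N n) * P n" for n
    unfolding Lambda_D_def
    using eigenmatrix[OF P D_op_carrier D[where n = n]] by (simp only: eigenvalue_D_def)
  moreover have "symmetric_W N (D_op N)"
    using D_op_carrier pairing_symmetric_D_op by (rule symmetric_W_rows)
  moreover have "(\<forall>n. P n \<lhd>\<^sub>D E_op N = const_mat (Lambda_E N n) * P n)
        \<and> diffops_commute N (D_op N) (E_op N) \<and> symmetric_W N (E_op N)" if "N > 0"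
  proof (intro conjI allI)
    have E: "row_act N (E_op N) (mat_row (P n) i) c = smult (eigenvalue_E N n i) (mat_row (P n) i c)"
      if "i \<le> N" "c \<le> N" for n i c
      using pairing_symmetric_E_op[OF \<open>N > 0\<close>] coeff_row_act_E_op that by (rule eigenrow_top)
    show "P n \<lhd>\<^sub>D E_op N = const_mat (Lambda_E N n) * P n" for n
      unfolding Lambda_E_def
      using eigenmatrix[OF P E_op_carrier E[where n = n]] by (simp only: eigenvalue_E_def)
    show "symmetric_W N (E_op N)"
      using E_op_carrier pairing_symmetric_E_op[OF that] by (rule symmetric_W_rows)
    show "diffops_commute N (D_op N) (E_op N)"
      unfolding diffops_commute_def
    proof
      fix Q assume Q: "Q \<in> matpolys N"
      have QD: "Q \<lhd>\<^sub>D D_op N \<in> matpolys N"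
        by (rule act_row(1)[OF Q D_op_carrier])
      have QE: "Q \<lhd>\<^sub>D E_op N \<in> matpolys N"
        by (rule act_row(1)[OF Q E_op_carrier])
      show "(Q \<lhd>\<^sub>D D_op N) \<lhd>\<^sub>D E_op N = (Q \<lhd>\<^sub>D E_op N) \<lhd>\<^sub>D D_op N"
      proof (rule matpolys_eqI[of _ N])
        fix i c assume i: "i \<le> N" and c: "c \<le> N"
        have "mat_row ((Q \<lhd>\<^sub>D D_op N) \<lhd>\<^sub>D E_op N) i c
          = row_act N (E_op N) (mat_row (Q \<lhd>\<^sub>D D_op N) i) c"
          by (rule act_row(2)[OF QD E_op_carrier i c])
        also have "\<dots> = row_act N (E_op N) (row_act N (D_op N) (mat_row Q i)) c"
          by (intro row_act_cong act_row(2)[OF Q D_op_carrier i])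
        also have "\<dots> = row_act N (D_op N) (row_act N (E_op N) (mat_row Q i)) c"
          using D E c by (rule commute_rows)
        also have "\<dots> = row_act N (D_op N) (mat_row (Q \<lhd>\<^sub>D E_op N) i) c"
          by (intro row_act_cong act_row(2)[OF Q E_op_carrier i, symmetric])
        also have "\<dots> = mat_row ((Q \<lhd>\<^sub>D E_op N) \<lhd>\<^sub>D D_op N) i c"
          by (rule act_row(2)[OF QE D_op_carrier i c, symmetric])
        finally show "mat_row ((Q \<lhd>\<^sub>D D_op N) \<lhd>\<^sub>D E_op N) i c
          = mat_row ((Q \<lhd>\<^sub>D E_op N) \<lhd>\<^sub>D D_op N) i c" .
      qed (rule act_row(1)[OF QD E_op_carrier], assumption,
          rule act_row(1)[OF QE D_op_carrier])
    qed
  qed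
  ultimately show ?thesis by blast
qed

end
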